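(* Let $r$ be a positive integer and $n$ a non-negative integer. Then $$\sum_{k_1,\dots,k_r=-n}^n\ \prod_{1\le i<j\le r}\big|k_i^2-k_j^2\big|\ \prod_{i=1}^r\binom{2n}{n+k_i} =2^{2rn-r(r-1)}\,\frac{\Gamma(1+\frac r2)}{\Gamma(\frac32)}\cdot\frac{\Gamma(n-\frac r2+\frac32)}{\Gamma(n+1)}\prod_{i=1}^{r-1}\frac{\Gamma(i+1)}{\Gamma(\frac32)}\cdot\frac{\Gamma(2n+1)\,\Gamma(n-i+\frac32)}{\Gamma(2n-i+1)\,\Gamma(n-i+1)}.$$
   Context: Convention: $1/\Gamma(x)=0$ for $x\in\{0,-1,-2,\dots\}$; if a numerator gamma factor also has a pole (which happens only for odd $r$ and $0\le n\le (r-3)/2$), the right-hand side is understood as its limiting value when $n$ is replaced by $n+\varepsilon$, $\varepsilon\to0$, which is $0$ (for $0\le n\le r-2$ both sides vanish). *)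

theory Defs
  imports "HOL-Analysis.Analysis"
begin

definition binomial_sum :: "nat \<Rightarrow> nat \<Rightarrow> int" where
  "binomial_sum r n =
     (\<Sum>k \<in> {1..r} \<rightarrow>\<^sub>E {- int n..int n}.
        (\<Prod>(i, j) \<in> {(i, j). 1 \<le> i \<and> i < j \<and> j \<le> r}. \<bar>(k i)\<^sup>2 - (k j)\<^sup>2\<bar>) *
        (\<Prod>i = 1..r. int ((2 * n) choose nat (int n + k i))))"

(* The argument x is real, rather than a natural number, so that the limit x = n + \<epsilon>, \<epsilon> \<rightarrow> 0,
   can be formed.  Factors 1 / Gamma(y) depending on x are written as rGamma y, the entire
   function which is 0 at the poles y = 0, -1, -2, ... of Gamma. *)
definition gamma_product :: "nat \<Rightarrow> real \<Rightarrow> real" where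
  "gamma_product r x =
     2 powr (2 * real r * x - real r * (real r - 1)) *
     (Gamma (1 + real r / 2) / Gamma (3 / 2)) *
     (Gamma (x - real r / 2 + 3 / 2) * rGamma (x + 1)) *
     (\<Prod>i = 1..r - 1.
        (Gamma (real i + 1) / Gamma (3 / 2)) *
        (Gamma (2 * x + 1) * Gamma (x - real i + 3 / 2) *
         rGamma (2 * x - real i + 1) * rGamma (x - real i + 1)))"

end

theory Submission
  imports Defs "Jordan_Normal_Form.Determinant" "HOL-Combinatorics.Multiset_Permutations"
begin

text \<open>
  The proof has three steps. Throughout, m = n + 1 - r; if r > n + 1, both sides vanish,
  the right-hand side possibly only in the limit.

  First, only the |k_i| matter, and they have to be distinct. The total weight of the nodes k with
  |k| = a is (2n)! divided by the product of the |l^2 - a^2| over the other nodes l in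
  {0, ..., n} (\<open>fibre_sum\<close>). These are the barycentric weights of the nodes 0, 1, 4, ..., n^2, and
  for such weights the Vandermonde product of an r-element set of nodes becomes the Vandermonde
  product of its complement (\<open>vdm_complement\<close>). The sum is therefore, up to explicit factors, the
  unweighted sum of the products of the b^2 - a^2 over all m-element subsets of {0, ..., n}
  (\<open>binomial_sum_eq_sum_subsets\<close>).

  Secondly, this sum is evaluated in closed form. It is a limit, as t \<rightarrow> 0, of the sum over all
  m-element sets of exponents a of the determinants of the 2 cosh (a \<theta>_i), because for
  \<theta>_i = (i + 1/2) t these determinants are Vandermonde determinants in the 2 cosh (a t). For
  arbitrary angles \<theta>_i the sum factorises into two determinants, one of hyperbolic sines and one of
  hyperbolic cosines (\<open>alternant_sum_cosh\<close>). In terms of characters of so(2m), symmetrised under a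
  change of sign of the last coordinate of the weight, the sum over all partitions in a rectangle is
  the product of a character of so(2m+1) and a symmetrised character of so(2m), both of rectangular
  highest weight. The factorisation is obtained by writing
  2 cosh (a \<theta>) = exp (a \<theta>) + exp (- a \<theta>) and by summing, for each choice of signs, the
  determinants of powers with exponents below a bound (\<open>alternant_sum_powers\<close>). The latter sum is a
  single determinant over an explicit denominator; it is verified by induction on the bound with the
  partial fraction identity \<open>sum_cauchy_ratio\<close>. Up to an elementary factor, its numerator does not
  depend on the choice of signs, so it can be taken out of the sum over the signs, and what remains
  is the expansion of the second determinant. At the angles (i + 1/2) t all determinants are
  Vandermonde determinants again, and the limit t \<rightarrow> 0 gives a product formula (\<open>sum_vdm_squares\<close>).

  Thirdly, this product formula is identified with the product of Gamma functions by induction on m,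
  using the functional equation and the duplication formula at half-integers.
\<close>

section \<open>Divided differences and a partial fraction identity\<close>

text \<open>
  By Lagrange interpolation, P is determined by its values on A, and the left-hand side is the top
  coefficient of the interpolating polynomial.
\<close>
lemma divided_difference_poly:
  fixes A :: "real set" and P :: "real poly"
  assumes fin: "finite A" and deg: "degree P < card A"
  shows "(\<Sum>a\<in>A. poly P a / (\<Prod>b\<in>A - {a}. a - b)) = coeff P (card A - 1)"
proof -
  define B where "B a = (\<Prod>b\<in>A - {a}. [:-b, 1:])" for a :: real
  define Q where "Q = (\<Sum>a\<in>A. Polynomial.smult (poly P a / (\<Prod>b\<in>A - {a}. a - b)) (B a))"
  have degB: "degree (B a) = card A - 1" if "a \<in> A" for a
  proof -
    have "degree (B a) = (\<Sum>b\<in>A - {a}. degree [:-b, 1:])"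
      unfolding B_def by (intro degree_prod_eq_sum_degree) auto
    then show ?thesis using that fin by simp
  qed
  have lcB: "coeff (B a) (card A - 1) = 1" if "a \<in> A" for a
    using degB[OF that] lead_coeff_prod[of "\<lambda>b. [:-b, 1:]" "A - {a}"] by (simp add: B_def)
  have polyB: "poly (B a) c = (if c = a then (\<Prod>b\<in>A - {a}. a - b) else 0)"
    if "a \<in> A" "c \<in> A" for a c
    using that fin by (auto simp: B_def poly_prod intro!: bexI[of _ c])
  have "poly P c = poly Q c" if c: "c \<in> A" for c
  proof -
    have "poly Q c = (\<Sum>a\<in>A. if c = a then poly P c else 0)"
      unfolding Q_def poly_sum
    proof (rule sum.cong[OF refl])
      fix a assume a: "a \<in> A"
      have "(\<Prod>b\<in>A - {a}. a - b) \<noteq> 0" using fin by auto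
      then show "poly (Polynomial.smult (poly P a / (\<Prod>b\<in>A - {a}. a - b)) (B a)) c = (if c = a then poly P c else 0)"
        by (simp add: polyB[OF a c])
    qed
    then show ?thesis using c fin by simp
  qed
  moreover have "degree Q \<le> card A - 1"
    unfolding Q_def by (intro degree_sum_le fin order_trans[OF degree_smult_le]) (simp add: degB)
  then have "degree Q < card A" using deg by linarith
  ultimately have "P = Q" using deg by (intro poly_eqI_degree[of A]) auto
  then have "coeff P (card A - 1) = coeff Q (card A - 1)" by simp
  also have "\<dots> = (\<Sum>a\<in>A. poly P a / (\<Prod>b\<in>A - {a}. a - b))"
    unfolding Q_def coeff_sum by (intro sum.cong refl) (simp only: coeff_smult lcB mult_1_right)
  finally show ?thesis by simp
qed

text \<open>
  The polynomial \<Prod>_j (1 - z y_j) has degree |S| in z, so its divided difference at the |S| + 1 nodes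
  y_i and -1 is its leading coefficient. The node -1 yields the constant term 1, and its presence
  among the nodes reduces the factor 1 - y_i^2 of the value at y_i to 1 - y_i.
\<close>
lemma sum_cauchy_ratio:
  fixes y :: "'i \<Rightarrow> real"
  assumes fin: "finite S" and inj: "inj_on y S" and ne: "\<And>i. i \<in> S \<Longrightarrow> y i \<noteq> -1"
  shows "(\<Sum>i\<in>S. (1 - y i) * (\<Prod>j\<in>S - {i}. (1 - y i * y j) / (y j - y i))) = 1 - (\<Prod>i\<in>S. y i)"
proof -
  define P where "P = (\<Prod>j\<in>S. [:1, - y j:])"
  define A where "A = insert (-1) (y ` S)"
  have nm: "-1 \<notin> y ` S" using ne by force
  have cA: "card A = Suc (card S)"
    using fin inj nm by (simp add: A_def card_image)
  have degP: "degree P \<le> card S"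
  proof -
    have "degree P \<le> (\<Sum>j\<in>S. degree [:1, - y j:])" using degree_prod_sum_le[OF fin, of "\<lambda>j. [:1, - y j:]"] by (simp add: P_def comp_def)
    also have "\<dots> \<le> (\<Sum>j\<in>S. 1)" by (intro sum_mono) simp
    finally show ?thesis by simp
  qed
  have coP: "coeff P (card S) = (-1) ^ card S * (\<Prod>j\<in>S. y j)"
    unfolding P_def using fin
  proof induction
    case (insert x F)
    have "degree (\<Prod>j\<in>F. [:1, - y j:]) \<le> (\<Sum>j\<in>F. degree [:1, - y j:])"
      using degree_prod_sum_le[OF insert(1), of "\<lambda>j. [:1, - y j:]"] by (simp add: comp_def)
    also have "\<dots> \<le> (\<Sum>j\<in>F. 1)" by (intro sum_mono) simp
    finally have "coeff (\<Prod>j\<in>F. [:1, - y j:]) (Suc (card F)) = 0" by (intro coeff_eq_0) simp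
    then show ?case using insert by simp
  qed simp
  have pP: "poly P z = (\<Prod>j\<in>S. 1 - z * y j)" for z
    by (simp add: P_def poly_prod)
  have "(\<Sum>a\<in>A. poly P a / (\<Prod>b\<in>A - {a}. a - b)) = (-1) ^ card S * (\<Prod>j\<in>S. y j)"
    using divided_difference_poly[of A P] fin cA degP coP by (simp add: A_def)
  moreover have "(\<Sum>a\<in>A. poly P a / (\<Prod>b\<in>A - {a}. a - b)) =
     poly P (-1) / (\<Prod>b\<in>A - {-1}. -1 - b) + (\<Sum>i\<in>S. poly P (y i) / (\<Prod>b\<in>A - {y i}. y i - b))"
    unfolding A_def using fin nm inj by (simp add: sum.reindex)
  moreover have "poly P (-1) / (\<Prod>b\<in>A - {-1}. -1 - b) = (-1) ^ card S"
  proof -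
    have "A - {-1} = y ` S" using nm by (auto simp: A_def)
    then have "(\<Prod>b\<in>A - {-1}. -1 - b) = (\<Prod>j\<in>S. - (1 + y j))"
      using inj by (simp add: prod.reindex)
    also have "\<dots> = (-1) ^ card S * (\<Prod>j\<in>S. 1 + y j)" by (rule prod_uminus)
    finally show ?thesis using ne fin by (simp add: pP prod_zero_iff eq_neg_iff_add_eq_0 add.commute field_simps)
  qed
  moreover have "poly P (y i) / (\<Prod>b\<in>A - {y i}. y i - b) =
      - ((-1) ^ card S) * ((1 - y i) * (\<Prod>j\<in>S - {i}. (1 - y i * y j) / (y j - y i)))" if i: "i \<in> S" for i
  proof -
    have "A - {y i} = insert (-1) (y ` (S - {i}))" using ne[OF i] i inj by (auto simp: A_def inj_on_def)
    moreover have "-1 \<notin> y ` (S - {i})" using ne by force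
    ultimately have "(\<Prod>b\<in>A - {y i}. y i - b) = (y i + 1) * (\<Prod>j\<in>S - {i}. - (y j - y i))"
      using inj fin inj_on_subset[OF inj, of "S - {i}"] by (simp add: prod.reindex)
    also have "\<dots> = (y i + 1) * ((-1) ^ (card S - 1) * (\<Prod>j\<in>S - {i}. y j - y i))"
      unfolding prod_uminus using fin i by simp
    finally have den: "(\<Prod>b\<in>A - {y i}. y i - b) = (y i + 1) * ((-1) ^ (card S - 1) * (\<Prod>j\<in>S - {i}. y j - y i))" .
    have num: "poly P (y i) = (1 + y i) * (1 - y i) * (\<Prod>j\<in>S - {i}. 1 - y i * y j)"
      unfolding pP prod.remove[OF fin i] by (simp add: algebra_simps)
    have "card S = Suc (card S - 1)" using i fin by (metis card_gt_0_iff empty_iff Suc_pred')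
    then have sg: "(-1::real) ^ card S = - ((-1) ^ (card S - 1))" by (metis power_Suc mult_minus1)
    have "(-1::real) ^ k \<noteq> 0 \<and> 1 / (-1::real) ^ k = (-1) ^ k" for k by (simp add: field_simps flip: power_mult_distrib)
    then have inv: "x / ((-1::real) ^ k * z) = (-1) ^ k * (x / z)" for x z k
      by (metis times_divide_times_eq mult_1)
    have "y i + 1 \<noteq> 0" using ne[OF i] by linarith
    then show ?thesis
      unfolding den num sg prod_dividef
      by (simp add: add.commute inv mult.assoc)
  qed
  ultimately have "(-1) ^ card S + (\<Sum>i\<in>S. - ((-1) ^ card S) * ((1 - y i) * (\<Prod>j\<in>S - {i}. (1 - y i * y j) / (y j - y i))))
     = (-1) ^ card S * (\<Prod>j\<in>S. y j)"
    by simp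
  then have "(-1) ^ card S * (1 - (\<Sum>i\<in>S. (1 - y i) * (\<Prod>j\<in>S - {i}. (1 - y i * y j) / (y j - y i))))
     = (-1) ^ card S * (\<Prod>j\<in>S. y j)"
    by (simp only: sum_distrib_left[symmetric] right_diff_distrib mult_minus_left sum_negf mult_1_right)
  then show ?thesis by simp
qed

section \<open>Products over pairs of indices\<close>

text \<open>
  For symmetric functions this is a product over the two-element subsets of the index set. The order
  is needed for the differences in a Vandermonde product.
\<close>
definition pair_prod :: "('i::linorder \<Rightarrow> 'i \<Rightarrow> 'a::comm_monoid_mult) \<Rightarrow> 'i set \<Rightarrow> 'a" where
  "pair_prod f A = (\<Prod>(i, j)\<in>{(i, j). i \<in> A \<and> j \<in> A \<and> i < j}. f i j)"

lemma finite_pairs: "finite A \<Longrightarrow> finite {(i, j). i \<in> A \<and> j \<in> A \<and> (i::'i::linorder) < j}"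
  by (rule finite_subset[of _ "A \<times> A"]) auto

lemma pair_prod_empty [simp]: "pair_prod f {} = 1"
  by (simp add: pair_prod_def)

lemma pair_prod_insert:
  assumes fin: "finite A" and a: "a \<notin> A" and sym: "\<And>i j. f i j = f j i"
  shows "pair_prod f (insert a A) = pair_prod f A * (\<Prod>j\<in>A. f a j)"
proof -
  let ?P = "\<lambda>A. {(i, j). i \<in> A \<and> j \<in> A \<and> i < j}"
  let ?h = "\<lambda>j. if a < j then (a, j) else (j, a)"
  have "?P (insert a A) = ?P A \<union> ?h ` A" using a by (auto simp: image_iff not_less order.order_iff_strict)
  moreover have "?P A \<inter> ?h ` A = {}" using a by (auto split: if_splits)
  ultimately have "pair_prod f (insert a A) = pair_prod f A * (\<Prod>(i, j)\<in>?h ` A. f i j)"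
    unfolding pair_prod_def using fin by (simp add: prod.union_disjoint finite_pairs)
  also have "(\<Prod>(i, j)\<in>?h ` A. f i j) = (\<Prod>j\<in>A. f a j)"
  proof (subst prod.reindex)
    show "inj_on ?h A" using a by (auto simp: inj_on_def split: if_splits)
  qed (auto intro!: prod.cong simp: sym)
  finally show ?thesis .
qed

lemma pair_prod_remove:
  assumes "finite A" "a \<in> A" "\<And>i j. f i j = f j i"
  shows "pair_prod f A = pair_prod f (A - {a}) * (\<Prod>j\<in>A - {a}. f a j)"
  using pair_prod_insert[of "A - {a}" a f] assms by (simp add: insert_absorb)

lemma pair_prod_cong:
  assumes "\<And>i j. i \<in> A \<Longrightarrow> j \<in> A \<Longrightarrow> i < j \<Longrightarrow> f i j = g i j"
  shows "pair_prod f A = pair_prod g A"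
  unfolding pair_prod_def using assms by (intro prod.cong) auto

lemma pair_prod_mult: "pair_prod (\<lambda>i j. f i j * g i j) A = pair_prod f A * pair_prod g A"
  unfolding pair_prod_def by (simp add: case_prod_beta prod.distrib)

lemma pair_prod_divide:
  "pair_prod (\<lambda>i j. f i j / g i j :: 'a::field) A = pair_prod f A / pair_prod g A"
  unfolding pair_prod_def by (simp add: case_prod_beta prod_dividef)

lemma pair_prod_abs: "\<bar>pair_prod f A\<bar> = pair_prod (\<lambda>i j. \<bar>f i j :: 'a::linordered_field\<bar>) A"
  unfolding pair_prod_def by (simp add: case_prod_beta abs_prod)

lemma pair_prod_nonzero:
  assumes "finite A" "\<And>i j. i \<in> A \<Longrightarrow> j \<in> A \<Longrightarrow> i < j \<Longrightarrow> f i j \<noteq> 0"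
  shows "pair_prod f A \<noteq> (0::'a::semidom)"
  unfolding pair_prod_def using assms finite_pairs[OF assms(1)] by (auto simp: prod_zero_iff)

lemma pair_prod_pos:
  assumes "\<And>i j. i \<in> A \<Longrightarrow> j \<in> A \<Longrightarrow> i < j \<Longrightarrow> f i j > 0"
  shows "pair_prod f A > (0::'a::linordered_semidom)"
  unfolding pair_prod_def using assms by (intro prod_pos) auto

lemma pair_prod_reindex:
  assumes "finite A" "inj_on h A" "\<And>i j. f i j = f j i"
  shows "pair_prod f (h ` A) = pair_prod (\<lambda>i j. f (h i) (h j)) A"
  using assms
proof (induction A)
  case (insert a A)
  then have ha: "h a \<notin> h ` A" and inj: "inj_on h A" by auto
  have "pair_prod f (h ` insert a A) = pair_prod f (h ` A) * (\<Prod>j\<in>h ` A. f (h a) j)"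
    using insert(1) ha insert.prems(2) by (simp add: pair_prod_insert)
  also have "(\<Prod>j\<in>h ` A. f (h a) j) = (\<Prod>j\<in>A. f (h a) (h j))"
    using inj by (simp add: prod.reindex)
  finally show ?case
    using insert inj by (simp add: pair_prod_insert)
qed simp

text \<open>
  Every index lies in as many pairs as there are other indices.
\<close>
lemma pair_prod_weights:
  assumes "finite A"
  shows "pair_prod (\<lambda>i j. c i * c j) A = (\<Prod>i\<in>A. c i ^ (card A - 1))"
  using assms
proof induction
  case (insert a A)
  have "pair_prod (\<lambda>i j. c i * c j) (insert a A) = (\<Prod>i\<in>A. c i ^ (card A - 1)) * (\<Prod>j\<in>A. c a * c j)"
    using insert by (simp add: pair_prod_insert mult.commute)
  also have "\<dots> = c a ^ card A * (\<Prod>i\<in>A. c i ^ (card A - 1) * c i)"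
    by (simp add: prod.distrib mult_ac)
  also have "(\<Prod>i\<in>A. c i ^ (card A - 1) * c i) = (\<Prod>i\<in>A. c i ^ card A)"
  proof (intro prod.cong refl)
    fix i assume "i \<in> A"
    then have "card A > 0" using insert(1) by (auto simp: card_gt_0_iff)
    then show "c i ^ (card A - 1) * c i = c i ^ card A"
      by (metis Suc_pred' power_Suc2)
  qed
  finally show ?case using insert by simp
qed simp

section \<open>Determinants of monic polynomials\<close>
abbreviation matrix_det :: "nat \<Rightarrow> (nat \<Rightarrow> nat \<Rightarrow> 'a::comm_ring_1) \<Rightarrow> 'a" where
  "matrix_det m f \<equiv> Determinant.det (mat m m (\<lambda>(i, j). f i j))"

lemma matrix_det_leibniz:
  "matrix_det m f = (\<Sum>p | p permutes {..<m}. of_int (sign p) * (\<Prod>i<m. f i (p i)))"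
  by (subst det_def'[of _ m]) (auto simp: atLeast0LessThan permutes_in_image intro!: sum.cong prod.cong)

text \<open>
  The coefficients of the polynomials form a unitriangular matrix.
\<close>
lemma det_monic_poly_eq_monomials:
  fixes P :: "nat \<Rightarrow> 'a::idom poly"
  assumes deg: "\<And>i. i < m \<Longrightarrow> degree (P i) = i" and lc: "\<And>i. i < m \<Longrightarrow> lead_coeff (P i) = 1"
  shows "matrix_det m (\<lambda>i j. poly (P i) (c j)) = matrix_det m (\<lambda>i j. c j ^ i)"
proof -
  let ?L = "mat m m (\<lambda>(i, k). coeff (P i) k)" and ?V = "mat m m (\<lambda>(k, j). c j ^ k)"
  have "mat m m (\<lambda>(i, j). poly (P i) (c j)) = ?L * ?V"
  proof (rule eq_matI)
    fix i j assume "i < dim_row (?L * ?V)" "j < dim_col (?L * ?V)"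
    then have i: "i < m" and j: "j < m" by auto
    have "poly (P i) (c j) = (\<Sum>k\<le>i. coeff (P i) k * c j ^ k)"
      using deg[OF i] by (simp add: poly_altdef)
    also have "\<dots> = (\<Sum>k<m. coeff (P i) k * c j ^ k)"
      using i deg[OF i] by (intro sum.mono_neutral_left) (auto intro!: coeff_eq_0)
    finally show "mat m m (\<lambda>(i, j). poly (P i) (c j)) $$ (i, j) = (?L * ?V) $$ (i, j)"
      using i j by (simp add: scalar_prod_def atLeast0LessThan)
  qed auto
  then have "matrix_det m (\<lambda>i j. poly (P i) (c j)) = Determinant.det ?L * Determinant.det ?V"
    by (simp add: Determinant.det_mult[of _ m])
  also have "Determinant.det ?L = prod_list (diag_mat ?L)"
    by (rule det_lower_triangular[of m]) (auto intro!: coeff_eq_0 simp: deg)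
  also have "\<dots> = 1" using lc deg by (simp add: prod_list_diag_prod)
  finally show ?thesis by simp
qed

text \<open>
  Since the determinant is the same for all families of monic polynomials, it may be computed for the
  Newton polynomials of the nodes, whose matrix of values is triangular.
\<close>
lemma det_monic_poly:
  fixes P :: "nat \<Rightarrow> 'a::idom poly"
  assumes deg: "\<And>i. i < m \<Longrightarrow> degree (P i) = i" and lc: "\<And>i. i < m \<Longrightarrow> lead_coeff (P i) = 1"
  shows "matrix_det m (\<lambda>i j. poly (P i) (c j)) = pair_prod (\<lambda>i j. c j - c i) {..<m}"
proof -
  define N where "N i = (\<Prod>k<i. [:- c k, 1:])" for i :: nat
  have degN: "degree (N i) = i" for i
    unfolding N_def by (subst degree_prod_eq_sum_degree) auto
  have lcN: "lead_coeff (N i) = 1" for i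
    unfolding N_def lead_coeff_prod by simp
  have "matrix_det m (\<lambda>i j. poly (N i) (c j)) = prod_list (diag_mat (mat m m (\<lambda>(i, j). poly (N i) (c j))))"
    by (rule det_upper_triangular[of _ m]) (auto simp: upper_triangular_def N_def poly_prod)
  also have "\<dots> = (\<Prod>j<m. \<Prod>i<j. c j - c i)"
    by (simp add: prod_list_diag_prod N_def poly_prod atLeast0LessThan)
  also have "\<dots> = (\<Prod>(j, i)\<in>(SIGMA j:{..<m}. {..<j}). c j - c i)"
    by (subst prod.Sigma) auto
  also have "\<dots> = pair_prod (\<lambda>i j. c j - c i) {..<m}"
    unfolding pair_prod_def by (rule prod.reindex_bij_witness[of _ prod.swap prod.swap]) auto
  finally show ?thesis
    using det_monic_poly_eq_monomials[of m N c] det_monic_poly_eq_monomials[of m P c] degN lcN deg lc by simp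
qed

lemma vandermonde_det: "matrix_det m (\<lambda>i j. (c i :: 'a::idom) ^ j) = pair_prod (\<lambda>i j. c j - c i) {..<m}"
proof -
  have "matrix_det m (\<lambda>i j. c i ^ j) = matrix_det m (\<lambda>i j. c j ^ i)"
    by (subst Determinant.det_transpose[of _ m, symmetric]) (auto intro!: arg_cong[of _ _ Determinant.det])
  also have "\<dots> = pair_prod (\<lambda>i j. c j - c i) {..<m}"
    using det_monic_poly[of m "\<lambda>i. monom 1 i" c] by (simp add: degree_monom_eq poly_monom)
  finally show ?thesis .
qed

lemma matrix_det_row_scale:
  "matrix_det m (\<lambda>i j. (d i :: 'a::comm_ring_1) * f i j) = (\<Prod>i<m. d i) * matrix_det m f"
  unfolding matrix_det_leibniz by (simp add: prod.distrib sum_distrib_left mult_ac)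

lemma matrix_det_col_scale:
  "matrix_det m (\<lambda>i j. (d j :: 'a::comm_ring_1) * f i j) = (\<Prod>j<m. d j) * matrix_det m f"
proof -
  have "(\<Prod>i<m. d (p i)) = (\<Prod>j<m. d j)" if "p permutes {..<m}" for p
    using that by (simp add: prod.permute[of p "{..<m}" d] comp_def)
  then show ?thesis
    unfolding matrix_det_leibniz by (auto simp: prod.distrib sum_distrib_left mult_ac intro!: sum.cong)
qed

lemma matrix_det_permute_rows:
  assumes p: "p permutes {..<m}"
  shows "matrix_det m (\<lambda>i j. f (p i) j) = of_int (sign p) * (matrix_det m f :: 'a::comm_ring_1)"
proof -
  have "mat m m (\<lambda>(i, j). f (p i) j) = mat m m (\<lambda>(i, j). mat m m (\<lambda>(i, j). f i j) $$ (p i, j))"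
    using permutes_in_image[OF p] by (intro eq_matI) auto
  then show ?thesis
    using det_permute_rows[of "mat m m (\<lambda>(i, j). f i j)" m p] p by (simp add: atLeast0LessThan)
qed

text \<open>
  This is how signs of permutations are traded for Vandermonde products.
\<close>
lemma vandermonde_permute:
  fixes p :: "nat \<Rightarrow> nat"
  assumes p: "p permutes {..<m}"
  shows "pair_prod (\<lambda>i j. c (p j) - c (p i)) {..<m} = of_int (sign p) * pair_prod (\<lambda>i j. c j - (c i :: 'a::idom)) {..<m}"
  using matrix_det_permute_rows[OF p, of "\<lambda>i j. c i ^ j"] vandermonde_det[of m "\<lambda>i. c (p i)"] vandermonde_det[of m c]
  by simp

section \<open>Sums of alternants of powers with bounded exponents\<close>

text \<open>
  The sum over all sets A of exponents below n with |A| = |I| of the determinant of the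
  g_i(a), divided by the Vandermonde product of the u_i (see \<open>alternant_sum_eq_sum_det\<close> below). The recursion
  expands the determinants with n \<in> A along the column of the exponent n. The division by the
  Vandermonde product removes all signs, so that the index set needs no enumeration.
\<close>
fun alternant_sum :: "('i \<Rightarrow> nat \<Rightarrow> real) \<Rightarrow> ('i \<Rightarrow> real) \<Rightarrow> nat \<Rightarrow> 'i set \<Rightarrow> real" where
  "alternant_sum g u 0 I = (if I = {} then 1 else 0)"
| "alternant_sum g u (Suc n) I = alternant_sum g u n I +
     (\<Sum>i\<in>I. g i n * alternant_sum g u n (I - {i}) / (\<Prod>j\<in>I - {i}. u i - u j))"

text \<open>
  The case i = j of the last condition excludes the values 1 and -1.
\<close>
definition generic_on :: "('i \<Rightarrow> real) \<Rightarrow> 'i set \<Rightarrow> bool" where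
  "generic_on y I \<longleftrightarrow> inj_on y I \<and> (\<forall>i\<in>I. y i \<noteq> 0) \<and> (\<forall>i\<in>I. \<forall>j\<in>I. y i * y j \<noteq> 1)"

lemma generic_on_subset: "generic_on y I \<Longrightarrow> J \<subseteq> I \<Longrightarrow> generic_on y J"
  unfolding generic_on_def using inj_on_subset by blast

lemma generic_onD:
  assumes "generic_on y I"
  shows "inj_on y I" "i \<in> I \<Longrightarrow> y i \<noteq> 0" "i \<in> I \<Longrightarrow> y i \<noteq> 1" "i \<in> I \<Longrightarrow> y i \<noteq> -1"
    "i \<in> I \<Longrightarrow> j \<in> I \<Longrightarrow> y i * y j \<noteq> 1"
  using assms unfolding generic_on_def by force+

definition cut_pair :: "'i set \<Rightarrow> ('i \<Rightarrow> real) \<Rightarrow> 'i \<Rightarrow> 'i \<Rightarrow> real" where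
  "cut_pair S y i j =
     (if i \<in> S then (if j \<in> S then - 1 / (1 - y i * y j) else 1 / (y i - y j))
      else (if j \<in> S then 1 / (y j - y i) else 1 / (1 - y i * y j)))"

text \<open>
  For 0 < y_i < 1 and without a bound on the exponents, the sum would be the term with S = {}. The bound
  n is accounted for by one correction term for each set S of variables that contribute the power y_i^n.
\<close>
definition cut_term :: "nat \<Rightarrow> ('i::linorder \<Rightarrow> real) \<Rightarrow> 'i set \<Rightarrow> 'i set \<Rightarrow> real" where
  "cut_term n y S I = (\<Prod>i\<in>I. (if i \<in> S then - (y i ^ n) else 1) / (1 - y i)) * pair_prod (cut_pair S y) I"

lemma cut_pair_commute: "cut_pair S y i j = cut_pair S y j i"
  by (simp add: cut_pair_def mult.commute)

lemma cut_term_cong: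
  assumes "S \<inter> I = S' \<inter> I"
  shows "cut_term n y S I = cut_term n y S' I"
  unfolding cut_term_def using assms
  by (intro arg_cong2[of _ _ _ _ "(*)"] prod.cong pair_prod_cong) (auto simp: cut_pair_def)

lemma cut_term_Suc:
  assumes "finite I" "S \<subseteq> I"
  shows "cut_term (Suc n) y S I = (\<Prod>i\<in>S. y i) * cut_term n y S I"
proof -
  have "(\<Prod>i\<in>I. (if i \<in> S then - (y i ^ Suc n) else 1) / (1 - y i)) =
      (\<Prod>i\<in>I. (if i \<in> S then y i else 1) * ((if i \<in> S then - (y i ^ n) else 1) / (1 - y i)))"
    by (intro prod.cong) auto
  also have "\<dots> = (\<Prod>i\<in>I. if i \<in> S then y i else 1) * (\<Prod>i\<in>I. (if i \<in> S then - (y i ^ n) else 1) / (1 - y i))"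
    by (rule prod.distrib)
  also have "(\<Prod>i\<in>I. if i \<in> S then y i else 1) = (\<Prod>i\<in>S. y i)"
    using assms by (simp add: prod.If_cases Int_absorb1)
  finally show ?thesis by (simp add: cut_term_def)
qed

text \<open>
  In the quotient of the two terms only the factors with the index i survive, and for j \<notin> S they
  cancel against the denominator on the left.
\<close>
lemma cut_term_remove:
  assumes fin: "finite I" and S: "S \<subseteq> I" and i: "i \<in> S" and gen: "generic_on y I"
  shows "y i ^ n * cut_term n y (S - {i}) (I - {i}) / (\<Prod>j\<in>I - {i}. y i - y j) =
    - ((1 - y i) * (\<Prod>j\<in>S - {i}. (1 - y i * y j) / (y j - y i))) * cut_term n y S I"
proof -
  have iI: "i \<in> I" using i S by auto
  let ?J = "I - {i}"
  have "cut_term n y S I = (- (y i ^ n) / (1 - y i)) * (\<Prod>k\<in>?J. (if k \<in> S then - (y k ^ n) else 1) / (1 - y k))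
      * (pair_prod (cut_pair S y) ?J * (\<Prod>j\<in>?J. cut_pair S y i j))"
    unfolding cut_term_def prod.remove[OF fin iI]
    using pair_prod_remove[OF fin iI, of "cut_pair S y"] cut_pair_commute[of S y] i by simp
  also have "\<dots> = (- (y i ^ n) / (1 - y i)) * cut_term n y S ?J * (\<Prod>j\<in>?J. cut_pair S y i j)"
    by (simp add: cut_term_def)
  also have "cut_term n y S ?J = cut_term n y (S - {i}) ?J"
    by (rule cut_term_cong) auto
  finally have eq: "cut_term n y S I = (- (y i ^ n) / (1 - y i)) * cut_term n y (S - {i}) ?J * (\<Prod>j\<in>?J. cut_pair S y i j)" .
  have "(\<Prod>j\<in>S - {i}. (1 - y i * y j) / (y j - y i)) * (\<Prod>j\<in>?J. cut_pair S y i j) =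
    (\<Prod>j\<in>?J. if j \<in> S then (1 - y i * y j) / (y j - y i) else 1) * (\<Prod>j\<in>?J. cut_pair S y i j)"
  proof -
    have "(\<Prod>j\<in>?J. if j \<in> S then (1 - y i * y j) / (y j - y i) else 1) = (\<Prod>j\<in>?J \<inter> S. (1 - y i * y j) / (y j - y i))"
      using fin by (simp add: prod.If_cases)
    also have "?J \<inter> S = S - {i}" using S by auto
    finally show ?thesis by simp
  qed
  also have "\<dots> = (\<Prod>j\<in>?J. 1 / (y i - y j))"
    unfolding prod.distrib[symmetric]
  proof (rule prod.cong[OF refl])
    fix j assume j: "j \<in> ?J"
    then have "y i * y j \<noteq> 1" "y i \<noteq> y j"
      using gen iI unfolding generic_on_def inj_on_def by blast+
    then show "(if j \<in> S then (1 - y i * y j) / (y j - y i) else 1) * cut_pair S y i j = 1 / (y i - y j)"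
      using i by (simp add: cut_pair_def divide_simps)
  qed
  also have "\<dots> = 1 / (\<Prod>j\<in>?J. y i - y j)" by (simp add: prod_dividef)
  finally have pr: "(\<Prod>j\<in>S - {i}. (1 - y i * y j) / (y j - y i)) * (\<Prod>j\<in>?J. cut_pair S y i j) = 1 / (\<Prod>j\<in>?J. y i - y j)" .
  have "y i \<noteq> 1" using generic_onD(3)[OF gen iI] .
  then have "- ((1 - y i) * (\<Prod>j\<in>S - {i}. (1 - y i * y j) / (y j - y i))) * cut_term n y S I
     = y i ^ n * cut_term n y (S - {i}) ?J * ((\<Prod>j\<in>S - {i}. (1 - y i * y j) / (y j - y i)) * (\<Prod>j\<in>?J. cut_pair S y i j))"
    unfolding eq by (simp add: field_simps)
  then show ?thesis unfolding pr by simp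
qed

lemma sum_Pow_remove:
  assumes "finite I"
  shows "(\<Sum>S\<in>Pow I. \<Sum>i\<in>S. F i (S - {i})) = (\<Sum>i\<in>I. \<Sum>S\<in>Pow (I - {i}). (F i S :: 'a::comm_monoid_add))"
proof -
  have "(\<Sum>S\<in>Pow I. \<Sum>i\<in>S. F i (S - {i})) = (\<Sum>(S, i)\<in>Sigma (Pow I) (\<lambda>S. S). F i (S - {i}))"
    using assms by (subst sum.Sigma) (auto intro: finite_subset)
  also have "\<dots> = (\<Sum>(i, S)\<in>Sigma I (\<lambda>i. Pow (I - {i})). F i S)"
    by (rule sum.reindex_bij_witness[of _ "\<lambda>(i, S). (insert i S, i)" "\<lambda>(S, i). (i, S - {i})"]) auto
  also have "\<dots> = (\<Sum>i\<in>I. \<Sum>S\<in>Pow (I - {i}). F i S)"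
    using assms by (subst sum.Sigma) auto
  finally show ?thesis .
qed

text \<open>
  Raising n by one multiplies the term of S by the product of the y_i with i \<in> S. The identity
  \<open>sum_cauchy_ratio\<close> distributes this change over the elements of S.
\<close>
lemma cut_sum_Suc:
  assumes fin: "finite I" and gen: "generic_on y I"
  shows "(\<Sum>S\<in>Pow I. cut_term (Suc n) y S I) = (\<Sum>S\<in>Pow I. cut_term n y S I) +
    (\<Sum>i\<in>I. y i ^ n * (\<Sum>S\<in>Pow (I - {i}). cut_term n y S (I - {i})) / (\<Prod>j\<in>I - {i}. y i - y j))"
proof -
  have "cut_term (Suc n) y S I = cut_term n y S I +
     (\<Sum>i\<in>S. y i ^ n * cut_term n y (S - {i}) (I - {i}) / (\<Prod>j\<in>I - {i}. y i - y j))" if S: "S \<in> Pow I" for S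
  proof -
    have S: "S \<subseteq> I" and genS: "generic_on y S" and finS: "finite S"
      using that generic_on_subset[OF gen] finite_subset fin by auto
    have "(\<Sum>i\<in>S. y i ^ n * cut_term n y (S - {i}) (I - {i}) / (\<Prod>j\<in>I - {i}. y i - y j)) =
       (\<Sum>i\<in>S. - ((1 - y i) * (\<Prod>j\<in>S - {i}. (1 - y i * y j) / (y j - y i))) * cut_term n y S I)"
      by (intro sum.cong refl cut_term_remove fin S gen)
    also have "\<dots> = - (1 - (\<Prod>i\<in>S. y i)) * cut_term n y S I"
      unfolding sum_distrib_right[symmetric] sum_negf
      using sum_cauchy_ratio[OF finS generic_onD(1)[OF genS] generic_onD(4)[OF genS]] by simp
    finally show ?thesis by (simp add: cut_term_Suc[OF fin S] algebra_simps)
  qed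
  then have "(\<Sum>S\<in>Pow I. cut_term (Suc n) y S I) = (\<Sum>S\<in>Pow I. cut_term n y S I) +
     (\<Sum>S\<in>Pow I. \<Sum>i\<in>S. y i ^ n * cut_term n y (S - {i}) (I - {i}) / (\<Prod>j\<in>I - {i}. y i - y j))"
    by (simp add: sum.distrib)
  also have "(\<Sum>S\<in>Pow I. \<Sum>i\<in>S. y i ^ n * cut_term n y (S - {i}) (I - {i}) / (\<Prod>j\<in>I - {i}. y i - y j))
     = (\<Sum>i\<in>I. \<Sum>S\<in>Pow (I - {i}). y i ^ n * cut_term n y S (I - {i}) / (\<Prod>j\<in>I - {i}. y i - y j))"
    by (rule sum_Pow_remove[OF fin])
  finally show ?thesis by (simp add: sum_distrib_left sum_divide_distrib)
qed

text \<open>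
  After multiplication by the common denominator, the term of S is a Vandermonde determinant in which
  y_i is replaced by 1 / y_i for i \<in> S. The determinant on the right is the sum of these by linearity in
  each row.
\<close>
lemma cut_sum_det:
  fixes y :: "nat \<Rightarrow> real"
  assumes gen: "generic_on y {..<m}"
  shows "(\<Sum>S\<in>Pow {..<m}. cut_term n y S {..<m}) =
    matrix_det m (\<lambda>i j. y i ^ j - (1 / y i) ^ j * y i ^ (n + m - 1)) /
    ((\<Prod>i<m. 1 - y i) * pair_prod (\<lambda>i j. (y j - y i) * (1 - y i * y j)) {..<m})"
proof -
  let ?I = "{..<m}" and ?N = "n + m - 1"
  define z where "z S i = (if i \<in> S then 1 / y i else y i)" for S i
  have expand: "matrix_det m (\<lambda>i j. y i ^ j - (1 / y i) ^ j * y i ^ ?N) =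
      (\<Sum>S\<in>Pow ?I. (\<Prod>i\<in>?I. if i \<in> S then - (y i ^ ?N) else 1) * matrix_det m (\<lambda>i j. z S i ^ j))"
  proof -
    have "(\<Prod>i<m. y i ^ p i - (1 / y i) ^ p i * y i ^ ?N) =
       (\<Sum>S\<in>Pow ?I. (\<Prod>i\<in>?I. if i \<in> S then - (y i ^ ?N) else 1) * (\<Prod>i<m. z S i ^ p i))" for p
    proof -
      have "(\<Prod>i<m. - ((1 / y i) ^ p i * y i ^ ?N) + y i ^ p i) =
        (\<Sum>S\<in>Pow ?I. (\<Prod>i\<in>S. - ((1 / y i) ^ p i * y i ^ ?N)) * (\<Prod>i\<in>?I - S. y i ^ p i))"
        by (rule prod_add) simp
      also have "\<dots> = (\<Sum>S\<in>Pow ?I. (\<Prod>i\<in>?I. if i \<in> S then - ((1 / y i) ^ p i * y i ^ ?N) else y i ^ p i))"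
        by (intro sum.cong refl) (auto simp: prod.If_cases Int_absorb1 Diff_eq)
      also have "\<dots> = (\<Sum>S\<in>Pow ?I. (\<Prod>i\<in>?I. (if i \<in> S then - (y i ^ ?N) else 1) * z S i ^ p i))"
        by (intro sum.cong prod.cong refl) (auto simp: z_def)
      finally show ?thesis by (simp add: prod.distrib)
    qed
    then have "matrix_det m (\<lambda>i j. y i ^ j - (1 / y i) ^ j * y i ^ ?N) =
      (\<Sum>p | p permutes ?I. \<Sum>S\<in>Pow ?I. of_int (sign p) *
         ((\<Prod>i\<in>?I. if i \<in> S then - (y i ^ ?N) else 1) * (\<Prod>i<m. z S i ^ p i)))"
      by (simp only: matrix_det_leibniz sum_distrib_left)
    also have "\<dots> = (\<Sum>S\<in>Pow ?I. \<Sum>p | p permutes ?I. of_int (sign p) *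
         ((\<Prod>i\<in>?I. if i \<in> S then - (y i ^ ?N) else 1) * (\<Prod>i<m. z S i ^ p i)))"
      by (rule sum.swap)
    also have "\<dots> = (\<Sum>S\<in>Pow ?I. (\<Prod>i\<in>?I. if i \<in> S then - (y i ^ ?N) else 1) * matrix_det m (\<lambda>i j. z S i ^ j))"
      unfolding matrix_det_leibniz sum_distrib_left by (intro sum.cong refl) (simp only: mult_ac)
    finally show ?thesis .
  qed
  have each: "(\<Prod>i\<in>?I. if i \<in> S then - (y i ^ ?N) else 1) * matrix_det m (\<lambda>i j. z S i ^ j) =
     cut_term n y S ?I * ((\<Prod>i<m. 1 - y i) * pair_prod (\<lambda>i j. (y j - y i) * (1 - y i * y j)) ?I)"
    if S: "S \<subseteq> ?I" for S
  proof -
    define c where "c i = (if i \<in> S then 1 / y i else 1)" for i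
    have "pair_prod (\<lambda>i j. z S j - z S i) ?I =
       pair_prod (\<lambda>i j. cut_pair S y i j * ((y j - y i) * (1 - y i * y j)) * (c i * c j)) ?I"
    proof (rule pair_prod_cong)
      fix i j assume ij: "i \<in> ?I" "j \<in> ?I" "i < j"
      then have "y i \<noteq> 0" "y j \<noteq> 0" "y i * y j \<noteq> 1" "y i \<noteq> y j"
        using gen by (auto simp: generic_on_def inj_on_def)
      then show "z S j - z S i = cut_pair S y i j * ((y j - y i) * (1 - y i * y j)) * (c i * c j)"
        by (simp add: z_def c_def cut_pair_def divide_simps) (auto simp: algebra_simps)
    qed
    also have "\<dots> = pair_prod (cut_pair S y) ?I * pair_prod (\<lambda>i j. (y j - y i) * (1 - y i * y j)) ?I * (\<Prod>i<m. c i ^ (m - 1))"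
      by (subst pair_prod_mult, subst pair_prod_weights, simp, subst pair_prod_mult, simp)
    finally have vd: "matrix_det m (\<lambda>i j. z S i ^ j) = \<dots>" by (simp add: vandermonde_det)
    have "(\<Prod>i\<in>?I. if i \<in> S then - (y i ^ ?N) else 1) * (\<Prod>i<m. c i ^ (m - 1)) =
      (\<Prod>i\<in>?I. if i \<in> S then - (y i ^ n) else 1)"
      unfolding prod.distrib[symmetric]
    proof (rule prod.cong[OF refl])
      fix i assume i: "i \<in> ?I"
      then have "y i \<noteq> 0" and "?N = n + (m - 1)" using generic_onD(2)[OF gen] by auto
      then show "(if i \<in> S then - (y i ^ ?N) else 1) * c i ^ (m - 1) = (if i \<in> S then - (y i ^ n) else 1)"
        by (simp add: c_def power_add power_one_over)
    qed
    moreover have "(\<Prod>i\<in>?I. if i \<in> S then - (y i ^ n) else 1) = (\<Prod>i\<in>?I. (if i \<in> S then - (y i ^ n) else 1) / (1 - y i)) * (\<Prod>i<m. 1 - y i)"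
      unfolding prod.distrib[symmetric] using generic_onD(3)[OF gen] by (intro prod.cong) auto
    ultimately show ?thesis unfolding vd cut_term_def by (simp add: mult_ac)
  qed
  have "(\<Prod>i<m. 1 - y i) \<noteq> 0" using generic_onD(3)[OF gen] by auto
  moreover have "pair_prod (\<lambda>i j. (y j - y i) * (1 - y i * y j)) ?I \<noteq> 0"
  proof (rule pair_prod_nonzero)
    fix i j assume "i \<in> ?I" "j \<in> ?I" "i < j"
    then have "y i \<noteq> y j" "y i * y j \<noteq> 1"
      using gen by (auto simp: generic_on_def inj_on_def)
    then show "(y j - y i) * (1 - y i * y j) \<noteq> 0" by simp
  qed simp
  ultimately show ?thesis
    unfolding expand using each by (simp add: sum_distrib_right[symmetric])
qed

lemma cut_term_reindex:
  assumes "finite I" "inj_on h I" "S \<subseteq> I"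
  shows "cut_term n y (h ` S) (h ` I) = cut_term n (y \<circ> h) S I"
proof -
  have mem: "h i \<in> h ` S \<longleftrightarrow> i \<in> S" if "i \<in> I" for i
    using assms that by (auto simp: inj_on_def)
  have "pair_prod (cut_pair (h ` S) y) (h ` I) = pair_prod (\<lambda>i j. cut_pair (h ` S) y (h i) (h j)) I"
    using assms by (intro pair_prod_reindex) (auto intro: cut_pair_commute)
  also have "\<dots> = pair_prod (cut_pair S (y \<circ> h)) I"
    by (rule pair_prod_cong) (simp add: cut_pair_def mem)
  finally show ?thesis
    unfolding cut_term_def using assms by (auto simp: prod.reindex mem intro!: prod.cong)
qed

text \<open>
  For n = 0 the first and the last column of the determinant in \<open>cut_sum_det\<close> are opposite to each
  other. That determinant needs an initial segment as its index set, hence the change of indices.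
\<close>
lemma cut_sum_0:
  fixes y :: "'i::linorder \<Rightarrow> real"
  assumes fin: "finite I" and ne: "I \<noteq> {}" and gen: "generic_on y I"
  shows "(\<Sum>S\<in>Pow I. cut_term 0 y S I) = 0"
proof -
  define m where "m = card I"
  obtain h where h: "bij_betw h {..<m} I"
    using ex_bij_betw_nat_finite[OF fin] by (auto simp: m_def atLeast0LessThan)
  have inj: "inj_on h {..<m}" and im: "h ` {..<m} = I" using h by (auto simp: bij_betw_def)
  have m: "m > 0" using fin ne by (auto simp: m_def card_gt_0_iff)
  let ?y = "y \<circ> h"
  have gen': "generic_on ?y {..<m}"
    using gen inj im by (auto simp: generic_on_def intro: comp_inj_on)
  have "(\<Sum>S\<in>Pow I. cut_term 0 y S I) = (\<Sum>S\<in>Pow {..<m}. cut_term 0 y (h ` S) (h ` {..<m}))"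
    using im image_Pow_surj[OF im] inj_on_image_Pow[OF inj] by (metis (mono_tags, lifting) sum.reindex_cong)
  also have "\<dots> = (\<Sum>S\<in>Pow {..<m}. cut_term 0 ?y S {..<m})"
    using inj by (intro sum.cong refl cut_term_reindex) auto
  also have "\<dots> = 0"
  proof -
    let ?A = "mat m m (\<lambda>(i, j). ?y i ^ j - (1 / ?y i) ^ j * ?y i ^ (0 + m - 1))"
    \<comment> \<open>For m = 1 the two columns coincide and vanish; the vector is then twice a unit vector.\<close>
    let ?v = "unit_vec m 0 + unit_vec m (m - 1) :: real vec"
    have "?v $ 0 \<noteq> 0" using m by simp
    then have "?v \<noteq> 0\<^sub>v m" using m by (metis index_zero_vec(1))
    moreover have "?A *\<^sub>v ?v = 0\<^sub>v m"
    proof (rule eq_vecI)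
      fix i assume "i < dim_vec (0\<^sub>v m :: real vec)"
      then have i: "i < m" by simp
      then have "?y i \<noteq> 0" using generic_onD(2)[OF gen', of i] by simp
      then show "(?A *\<^sub>v ?v) $ i = 0\<^sub>v m $ i"
        using i m by (simp add: scalar_prod_add_distrib[of _ m] power_one_over)
    qed simp
    ultimately have "Determinant.det ?A = 0"
      using det_0_iff_vec_prod_zero_field[of ?A m] by (auto intro!: exI[of _ ?v])
    then show ?thesis unfolding cut_sum_det[OF gen'] by simp
  qed
  finally show ?thesis .
qed

text \<open>
  This is the bounded Littlewood identity for the sum of all Schur functions whose partition fits
  into a rectangle, with the determinant in its numerator expanded.
\<close>
theorem alternant_sum_powers:
  assumes "finite I" "generic_on y I"
  shows "alternant_sum (\<lambda>i a. y i ^ a) y n I = (\<Sum>S\<in>Pow I. cut_term n y S I)"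
  using assms
proof (induction n arbitrary: I)
  case 0
  then show ?case using cut_sum_0[of I y] by (auto simp: cut_term_def)
next
  case (Suc n)
  have "alternant_sum (\<lambda>i a. y i ^ a) y n (I - {i}) = (\<Sum>S\<in>Pow (I - {i}). cut_term n y S (I - {i}))" for i
    using Suc.prems by (intro Suc.IH generic_on_subset[OF Suc.prems(2)]) auto
  then show ?case
    using cut_sum_Suc[OF Suc.prems, of n] Suc.IH[OF Suc.prems] by simp
qed

section \<open>Factorisation of the sum of hyperbolic cosine alternants\<close>

lemma alternant_sum_cong:
  assumes "\<And>i. i \<in> I \<Longrightarrow> g i = g' i" "\<And>i. i \<in> I \<Longrightarrow> u i = u' i"
  shows "alternant_sum g u n I = alternant_sum g' u' n I"
  using assms
proof (induction n arbitrary: I)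
  case (Suc n)
  have "alternant_sum g u n I = alternant_sum g' u' n I" by (rule Suc.IH) (use Suc.prems in auto)
  moreover have "alternant_sum g u n (I - {i}) = alternant_sum g' u' n (I - {i})" for i
    by (rule Suc.IH) (use Suc.prems in auto)
  ultimately show ?case using Suc.prems by (auto intro!: sum.cong prod.cong arg_cong2[of _ _ _ _ "(/)"])
qed simp

lemma alternant_sum_empty: "alternant_sum g u n {} = 1"
  by (induction n) auto

lemma sum_Pow_split:
  assumes "finite I" "i \<in> I"
  shows "(\<Sum>R\<in>Pow I. f R) = (\<Sum>R\<in>Pow (I - {i}). f R + (f (insert i R) :: 'a::comm_monoid_add))"
proof -
  have "Pow I = Pow (I - {i}) \<union> insert i ` Pow (I - {i})"
    using Pow_insert[of i "I - {i}"] assms by (simp add: insert_absorb)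
  moreover have "Pow (I - {i}) \<inter> insert i ` Pow (I - {i}) = {}" by auto
  moreover have "inj_on (insert i) (Pow (I - {i}))" by (auto simp: inj_on_def)
  ultimately show ?thesis
    using assms by (simp add: sum.union_disjoint sum.reindex sum.distrib)
qed

definition invert_on :: "'i set \<Rightarrow> ('i \<Rightarrow> real) \<Rightarrow> 'i \<Rightarrow> real" where
  "invert_on R x i = (if i \<in> R then 1 / x i else x i)"

text \<open>
  Each power sum x_i^a + 1 / x_i^a is split into its two terms, and R is the set of indices where the
  second one is chosen. The pair factors convert between the two Vandermonde products, because
  (1 - 1 / (a b)) (a - b) = (a + 1/a) - (b + 1/b).
\<close>
theorem alternant_sum_symmetric:
  fixes x :: "'i::linorder \<Rightarrow> real"
  assumes "finite I" "\<And>i. i \<in> I \<Longrightarrow> x i \<noteq> 0"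
  shows "alternant_sum (\<lambda>i a. x i ^ a + (1 / x i) ^ a) (\<lambda>i. x i + 1 / x i) n I =
    (\<Sum>R\<in>Pow I. pair_prod (\<lambda>i j. 1 / (1 - 1 / (invert_on R x i * invert_on R x j))) I *
       alternant_sum (\<lambda>i a. invert_on R x i ^ a) (invert_on R x) n I)"
  using assms
proof (induction n arbitrary: I)
  case 0
  then show ?case by simp
next
  case (Suc n)
  let ?u = "\<lambda>i. x i + 1 / x i"
  let ?w = "\<lambda>R I. pair_prod (\<lambda>i j. 1 / (1 - 1 / (invert_on R x i * invert_on R x j))) I"
  let ?b = "\<lambda>R. alternant_sum (\<lambda>i a. invert_on R x i ^ a) (invert_on R x) n"
  have step: "?w R I * (invert_on R x i ^ n * ?b R (I - {i}) / (\<Prod>j\<in>I - {i}. invert_on R x i - invert_on R x j)) =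
    invert_on R x i ^ n * (?w R (I - {i}) * ?b R (I - {i})) / (\<Prod>j\<in>I - {i}. ?u i - ?u j)" if i: "i \<in> I" for i R
  proof -
    let ?y = "invert_on R x"
    have w: "?w R I = ?w R (I - {i}) * (\<Prod>j\<in>I - {i}. 1 / (1 - 1 / (?y i * ?y j)))"
      using Suc.prems i by (intro pair_prod_remove) (auto simp: mult.commute)
    have "(\<Prod>j\<in>I - {i}. 1 / (1 - 1 / (?y i * ?y j))) / (\<Prod>j\<in>I - {i}. ?y i - ?y j)
        = (\<Prod>j\<in>I - {i}. 1 / (1 - 1 / (?y i * ?y j)) / (?y i - ?y j))"
      by (rule prod_dividef[symmetric])
    also have "\<dots> = (\<Prod>j\<in>I - {i}. 1 / (?u i - ?u j))"
    proof (rule prod.cong[OF refl])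
      fix j assume "j \<in> I - {i}"
      then have nz: "x i \<noteq> 0" "x j \<noteq> 0" using Suc.prems(2) i by auto
      have "(1 - 1 / (a * b)) * (a - b) = (a + 1 / a) - (b + 1 / b)" if "a \<noteq> 0" "b \<noteq> 0" for a b :: real
        using that by (simp add: field_simps)
      moreover have "?y i \<noteq> 0" "?y j \<noteq> 0" "?y i + 1 / ?y i = ?u i" "?y j + 1 / ?y j = ?u j"
        using nz by (auto simp: invert_on_def)
      ultimately have "(1 - 1 / (?y i * ?y j)) * (?y i - ?y j) = ?u i - ?u j" by metis
      then show "1 / (1 - 1 / (?y i * ?y j)) / (?y i - ?y j) = 1 / (?u i - ?u j)"
        by (simp only: divide_divide_eq_left)
    qed
    also have "\<dots> = 1 / (\<Prod>j\<in>I - {i}. ?u i - ?u j)" by (simp add: prod_dividef)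
    finally have q: "(\<Prod>j\<in>I - {i}. 1 / (1 - 1 / (?y i * ?y j))) / (\<Prod>j\<in>I - {i}. ?y i - ?y j) = \<dots>" .
    have "?w R I * (?y i ^ n * ?b R (I - {i}) / (\<Prod>j\<in>I - {i}. ?y i - ?y j)) =
       ?y i ^ n * (?w R (I - {i}) * ?b R (I - {i})) *
        ((\<Prod>j\<in>I - {i}. 1 / (1 - 1 / (?y i * ?y j))) / (\<Prod>j\<in>I - {i}. ?y i - ?y j))"
      unfolding w by (simp add: mult_ac)
    then show ?thesis unfolding q by simp
  qed
  have split: "(\<Sum>R\<in>Pow I. invert_on R x i ^ n * (?w R (I - {i}) * ?b R (I - {i}))) =
     (x i ^ n + (1 / x i) ^ n) * (\<Sum>R\<in>Pow (I - {i}). ?w R (I - {i}) * ?b R (I - {i}))" if i: "i \<in> I" for i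
  proof -
    have "?w (insert i R) (I - {i}) = ?w R (I - {i})" for R
      by (rule pair_prod_cong) (auto simp: invert_on_def)
    moreover have "?b (insert i R) (I - {i}) = ?b R (I - {i})" for R
      by (rule alternant_sum_cong) (auto simp: invert_on_def)
    ultimately have "(\<Sum>R\<in>Pow I. invert_on R x i ^ n * (?w R (I - {i}) * ?b R (I - {i}))) =
      (\<Sum>R\<in>Pow (I - {i}). (x i ^ n + (1 / x i) ^ n) * (?w R (I - {i}) * ?b R (I - {i})))"
      unfolding sum_Pow_split[OF Suc.prems(1) i]
      by (intro sum.cong refl) (auto simp: invert_on_def algebra_simps)
    then show ?thesis by (simp add: sum_distrib_left)
  qed
  have IH: "alternant_sum (\<lambda>i a. x i ^ a + (1 / x i) ^ a) ?u n (I - {i}) =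
     (\<Sum>R\<in>Pow (I - {i}). ?w R (I - {i}) * ?b R (I - {i}))" for i
    by (rule Suc.IH) (use Suc.prems in auto)
  have "(\<Sum>R\<in>Pow I. ?w R I * alternant_sum (\<lambda>i a. invert_on R x i ^ a) (invert_on R x) (Suc n) I) =
    (\<Sum>R\<in>Pow I. ?w R I * ?b R I) + (\<Sum>R\<in>Pow I. \<Sum>i\<in>I. ?w R I * (invert_on R x i ^ n * ?b R (I - {i}) / (\<Prod>j\<in>I - {i}. invert_on R x i - invert_on R x j)))"
    by (simp add: distrib_left sum.distrib sum_distrib_left)
  also have "(\<Sum>R\<in>Pow I. \<Sum>i\<in>I. ?w R I * (invert_on R x i ^ n * ?b R (I - {i}) / (\<Prod>j\<in>I - {i}. invert_on R x i - invert_on R x j)))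
     = (\<Sum>i\<in>I. \<Sum>R\<in>Pow I. invert_on R x i ^ n * (?w R (I - {i}) * ?b R (I - {i})) / (\<Prod>j\<in>I - {i}. ?u i - ?u j))"
    by (subst sum.swap) (intro sum.cong refl step)
  also have "\<dots> = (\<Sum>i\<in>I. (x i ^ n + (1 / x i) ^ n) * alternant_sum (\<lambda>i a. x i ^ a + (1 / x i) ^ a) ?u n (I - {i}) / (\<Prod>j\<in>I - {i}. ?u i - ?u j))"
    by (intro sum.cong refl) (simp only: sum_divide_distrib[symmetric] split IH)
  also have "(\<Sum>R\<in>Pow I. ?w R I * ?b R I) = alternant_sum (\<lambda>i a. x i ^ a + (1 / x i) ^ a) ?u n I"
    by (rule Suc.IH[symmetric]) (use Suc.prems in auto)
  finally show ?case by simp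
qed

text \<open>
  A choice R of signs replaces \<theta>_i by \<phi>_i = \<plusminus> \<theta>_i and y_i = exp \<phi>_i. The
  numerator in \<open>cut_sum_det\<close> has rows y_i^j - y_i^(N - j) with N = n + m - 1, which are multiples of
  sinh ((N / 2 - j) \<theta>_i); the signs cancel against those of 1 - y_i. Hence the first determinant is a
  common factor of all terms, and the other factors are a Vandermonde product in the y_i and the powers
  y_i^((n - m) / 2). Their sum over R is the second determinant.
\<close>
theorem alternant_sum_cosh:
  fixes \<theta> :: "nat \<Rightarrow> real"
  assumes pos: "\<And>i. i < m \<Longrightarrow> \<theta> i > 0" and inj: "inj_on \<theta> {..<m}"
  shows "alternant_sum (\<lambda>i a. 2 * cosh (real a * \<theta> i)) (\<lambda>i. 2 * cosh (\<theta> i)) n {..<m} *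
      (pair_prod (\<lambda>i j. 2 * cosh (\<theta> j) - 2 * cosh (\<theta> i)) {..<m})\<^sup>2 * (\<Prod>i<m. 2 * sinh (\<theta> i / 2)) =
    pair_prod (\<lambda>i j. -1) {..<m} *
    matrix_det m (\<lambda>i j. 2 * sinh (((real n + real m - 1) / 2 - real j) * \<theta> i)) *
    matrix_det m (\<lambda>i j. 2 * cosh (((real n - real m) / 2 + real j) * \<theta> i))"
proof (cases "m = 0")
  case True
  have "matrix_det 0 f = 1" for f :: "nat \<Rightarrow> nat \<Rightarrow> real" by (rule det_dim_zero) simp
  then show ?thesis unfolding True lessThan_0 alternant_sum_empty pair_prod_empty prod.empty by simp
next
  case False
  then have m: "m > 0" by simp
  let ?I = "{..<m}"
  define N where "N = n + m - 1"
  have rN: "real N = real n + real m - 1" using m by (simp add: N_def of_nat_diff)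
  define \<phi> where "\<phi> R i = (if i \<in> R then - \<theta> i else \<theta> i)" for R i
  define y where "y R i = exp (\<phi> R i)" for R i
  let ?u = "\<lambda>i. 2 * cosh (\<theta> i)"
  let ?D = "pair_prod (\<lambda>i j. ?u j - ?u i) ?I"
  let ?S = "matrix_det m (\<lambda>i j. 2 * sinh ((real N / 2 - real j) * \<theta> i))"
  let ?c = "(real n - real m) / 2"
  have inv: "invert_on R (\<lambda>i. exp (\<theta> i)) = y R" for R
    by (auto simp: invert_on_def y_def \<phi>_def exp_minus field_simps)
  have ch: "exp z + 1 / exp z = 2 * cosh z" for z :: real
    by (simp add: cosh_def exp_minus field_simps)
  have pw: "exp (\<theta> i) ^ a + (1 / exp (\<theta> i)) ^ a = 2 * cosh (real a * \<theta> i)" for i a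
    by (simp add: power_one_over exp_of_nat_mult[symmetric] ch)
  have phi_ne: "\<phi> R i \<noteq> \<phi> R j" if "i < m" "j < m" "i \<noteq> j" for R i j
    using pos[OF that(1)] pos[OF that(2)] inj that by (auto simp: \<phi>_def inj_on_def)
  have phi_ne': "\<phi> R i + \<phi> R j \<noteq> 0" if "i < m" "j < m" for R i j
    using pos[OF that(1)] pos[OF that(2)] inj that by (auto simp: \<phi>_def inj_on_def)
  have gen: "generic_on (y R) ?I" for R
  proof -
    have "y R i * y R j \<noteq> 1" if "i < m" "j < m" for i j
      using phi_ne'[OF that, of R] by (simp add: y_def exp_add[symmetric])
    then show ?thesis
      using phi_ne[of _ _ R] unfolding generic_on_def inj_on_def by (auto simp: y_def)
  qed
  have uy: "y R i + 1 / y R i = ?u i" for R i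
    unfolding y_def ch by (simp add: \<phi>_def)
  have une: "?u i \<noteq> ?u j" if "i < m" "j < m" "i \<noteq> j" for i j
    using pos[OF that(1)] pos[OF that(2)] inj that cosh_real_strict_mono[of "\<theta> i" "\<theta> j"]
      cosh_real_strict_mono[of "\<theta> j" "\<theta> i"] by (auto simp: inj_on_def)
  have pairs: "pair_prod (\<lambda>i j. 1 / (1 - 1 / (y R i * y R j))) ?I / pair_prod (\<lambda>i j. (y R j - y R i) * (1 - y R i * y R j)) ?I
     = pair_prod (\<lambda>i j. -1) ?I * pair_prod (\<lambda>i j. y R j - y R i) ?I * (\<Prod>i<m. exp (- (real m - 1) * \<phi> R i)) / ?D\<^sup>2" for R
  proof -
    have "pair_prod (\<lambda>i j. 1 / (1 - 1 / (y R i * y R j)) / ((y R j - y R i) * (1 - y R i * y R j))) ?I =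
      pair_prod (\<lambda>i j. (-1 * (y R j - y R i) * (1 / y R i * (1 / y R j))) / ((?u j - ?u i) * (?u j - ?u i))) ?I"
    proof (rule pair_prod_cong)
      fix i j assume ij: "i \<in> ?I" "j \<in> ?I" "i < j"
      have nz: "y R i \<noteq> 0" "y R j \<noteq> 0" "y R i * y R j \<noteq> 1" "y R j \<noteq> y R i"
        using ij generic_onD(5)[OF gen] phi_ne[of j i R] by (auto simp: y_def)
      have "?u j - ?u i = (y R j - y R i) * (1 - 1 / (y R i * y R j))"
        unfolding uy[symmetric, of _ R] using nz by (simp add: field_simps)
      then have e: "?u j - ?u i = (y R j - y R i) * (y R i * y R j - 1) / (y R i * y R j)"
        using nz by (simp add: diff_divide_distrib right_diff_distrib)
      have e1: "1 / (1 - 1 / (a * b)) / ((b - a) * (1 - a * b)) = (-1 * (b - a) * (1 / a * (1 / b))) / (((b - a) * (a * b - 1) / (a * b)) * ((b - a) * (a * b - 1) / (a * b)))"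
        if "a \<noteq> 0" "b \<noteq> 0" "a * b \<noteq> 1" "b \<noteq> a" for a b :: real
      proof -
        define P where "P = a * b"
        define q where "q = b - a"
        have h: "P \<noteq> 0" "P \<noteq> 1" "q \<noteq> 0" using that by (auto simp: P_def q_def)
        define w where "w = P - 1"
        have w: "w \<noteq> 0" "1 - P = - w" using h by (auto simp: w_def)
        have "1 - 1 / P = w / P" using h by (simp add: w_def diff_divide_distrib)
        then have "1 / (1 - 1 / P) / (q * (1 - P)) = P / (w * (q * (- w)))"
          unfolding w(2) by simp
        also have "\<dots> = (-1 * q * (1 / P)) / ((q * w / P) * (q * w / P))"
          using h w(1) by (simp add: frac_eq_eq mult_ac)
        finally have "1 / (1 - 1 / P) / (q * (1 - P)) = (-1 * q * (1 / P)) / ((q * (P - 1) / P) * (q * (P - 1) / P))"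
          unfolding w_def .
        then show ?thesis by (simp add: P_def q_def)
      qed
      show "1 / (1 - 1 / (y R i * y R j)) / ((y R j - y R i) * (1 - y R i * y R j)) =
        (-1 * (y R j - y R i) * (1 / y R i * (1 / y R j))) / ((?u j - ?u i) * (?u j - ?u i))"
        unfolding e by (rule e1) (use nz in auto)
    qed
    also have "\<dots> = (pair_prod (\<lambda>i j. -1) ?I * pair_prod (\<lambda>i j. y R j - y R i) ?I * pair_prod (\<lambda>i j. 1 / y R i * (1 / y R j)) ?I) / (?D * ?D)"
      by (simp only: pair_prod_divide pair_prod_mult)
    also have "pair_prod (\<lambda>i j. 1 / y R i * (1 / y R j)) ?I = (\<Prod>i<m. exp (- (real m - 1) * \<phi> R i))"
    proof -
      have "pair_prod (\<lambda>i j. 1 / y R i * (1 / y R j)) ?I = (\<Prod>i<m. (1 / y R i) ^ (m - 1))"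
        using pair_prod_weights[of ?I "\<lambda>i. 1 / y R i"] by simp
      also have "\<dots> = (\<Prod>i<m. exp (- (real m - 1) * \<phi> R i))"
      proof (rule prod.cong[OF refl])
        fix i
        have "1 / y R i = exp (- \<phi> R i)" by (simp add: y_def exp_minus field_simps)
        then show "(1 / y R i) ^ (m - 1) = exp (- (real m - 1) * \<phi> R i)"
          using m by (simp add: exp_of_nat_mult[symmetric] of_nat_diff algebra_simps)
      qed
      finally show ?thesis .
    qed
    finally show ?thesis by (simp only: pair_prod_divide power2_eq_square)
  qed
  have rows: "matrix_det m (\<lambda>i j. y R i ^ j - (1 / y R i) ^ j * y R i ^ N) / (\<Prod>i<m. 1 - y R i) =
     (\<Prod>i<m. exp ((real N - 1) / 2 * \<phi> R i)) * ?S / (\<Prod>i<m. 2 * sinh (\<theta> i / 2))" for R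
  proof -
    define s :: "nat \<Rightarrow> real" where "s i = (if i \<in> R then -1 else 1)" for i
    have sphi: "\<phi> R i = s i * \<theta> i" for i by (simp add: s_def \<phi>_def)
    have ssh: "sinh (s i * z) = s i * sinh z" for i z by (simp add: s_def)
    have exps: "- exp a * (exp b - exp (- b)) = exp (a - b) - exp (a + b)" for a b :: real
      by (simp add: right_diff_distrib exp_add exp_diff exp_minus divide_inverse)
    have ent: "y R i ^ j - (1 / y R i) ^ j * y R i ^ N =
       (- s i * exp (real N / 2 * \<phi> R i)) * (2 * sinh ((real N / 2 - real j) * \<theta> i))" for i j
    proof -
      have "s i * (2 * sinh ((real N / 2 - real j) * \<theta> i)) = 2 * sinh ((real N / 2 - real j) * \<phi> R i)"
        unfolding sphi mult.left_commute[of _ "s i"] ssh by simp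
      also have "\<dots> = exp ((real N / 2 - real j) * \<phi> R i) - exp (- ((real N / 2 - real j) * \<phi> R i))"
        by (simp add: sinh_def)
      finally have A: "(- s i * exp (real N / 2 * \<phi> R i)) * (2 * sinh ((real N / 2 - real j) * \<theta> i)) =
         - exp (real N / 2 * \<phi> R i) * (exp ((real N / 2 - real j) * \<phi> R i) - exp (- ((real N / 2 - real j) * \<phi> R i)))"
        by (metis mult.assoc mult.commute mult_minus_left)
      also have "\<dots> = exp (real N / 2 * \<phi> R i - (real N / 2 - real j) * \<phi> R i) - exp (real N / 2 * \<phi> R i + (real N / 2 - real j) * \<phi> R i)"
        by (rule exps)
      also have "real N / 2 * \<phi> R i - (real N / 2 - real j) * \<phi> R i = real j * \<phi> R i" by (simp add: algebra_simps)
      also have "real N / 2 * \<phi> R i + (real N / 2 - real j) * \<phi> R i = real j * (- \<phi> R i) + real N * \<phi> R i" by (simp add: algebra_simps)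
      also have "exp (real j * \<phi> R i) - exp (real j * (- \<phi> R i) + real N * \<phi> R i) = y R i ^ j - (1 / y R i) ^ j * y R i ^ N"
      proof -
        have e: "1 / y R i = exp (- \<phi> R i)" by (simp add: y_def exp_minus field_simps)
        show ?thesis unfolding e unfolding y_def exp_add exp_of_nat_mult ..
      qed
      finally show ?thesis by simp
    qed
    have den: "1 - y R i = - s i * exp (\<phi> R i / 2) * (2 * sinh (\<theta> i / 2))" for i
    proof -
      have "s i * sinh (\<theta> i / 2) = sinh (\<phi> R i / 2)" using ssh[of i "\<theta> i / 2"] by (simp add: sphi)
      then have "- s i * exp (\<phi> R i / 2) * (2 * sinh (\<theta> i / 2)) = - exp (\<phi> R i / 2) * (2 * sinh (\<phi> R i / 2))"
        by (metis mult.assoc mult.commute mult_minus_left)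
      also have "\<dots> = exp (\<phi> R i / 2 - \<phi> R i / 2) - exp (\<phi> R i / 2 + \<phi> R i / 2)"
        unfolding exps[symmetric] by (simp add: sinh_def)
      finally show ?thesis by (simp add: y_def)
    qed
    have "matrix_det m (\<lambda>i j. y R i ^ j - (1 / y R i) ^ j * y R i ^ N) / (\<Prod>i<m. 1 - y R i) =
      ((\<Prod>i<m. - s i * exp (real N / 2 * \<phi> R i)) / (\<Prod>i<m. - s i * exp (\<phi> R i / 2))) * ?S / (\<Prod>i<m. 2 * sinh (\<theta> i / 2))"
      unfolding ent matrix_det_row_scale den prod.distrib by simp
    also have "(\<Prod>i<m. - s i * exp (real N / 2 * \<phi> R i)) / (\<Prod>i<m. - s i * exp (\<phi> R i / 2)) = (\<Prod>i<m. exp ((real N - 1) / 2 * \<phi> R i))"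
      unfolding prod_dividef[symmetric]
    proof (rule prod.cong[OF refl])
      fix i
      have "s i \<noteq> 0" by (simp add: s_def)
      then have "- s i * exp (real N / 2 * \<phi> R i) / (- s i * exp (\<phi> R i / 2)) = exp (real N / 2 * \<phi> R i - \<phi> R i / 2)"
        by (simp add: exp_diff)
      then show "- s i * exp (real N / 2 * \<phi> R i) / (- s i * exp (\<phi> R i / 2)) = exp ((real N - 1) / 2 * \<phi> R i)"
        by (simp add: diff_divide_distrib left_diff_distrib)
    qed
    finally show ?thesis .
  qed
  \<comment> \<open>Expanding each cosine into two exponentials gives a sum over R, and the Leibniz formula for each R is a Vandermonde determinant.\<close>
  have Csum: "(\<Sum>R\<in>Pow ?I. pair_prod (\<lambda>i j. y R j - y R i) ?I * (\<Prod>i<m. exp (?c * \<phi> R i))) =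
     matrix_det m (\<lambda>i j. 2 * cosh ((?c + real j) * \<theta> i))"
  proof -
    have pr: "(\<Prod>i<m. 2 * cosh ((?c + real (p i)) * \<theta> i)) = (\<Sum>R\<in>Pow ?I. (\<Prod>i<m. exp (?c * \<phi> R i)) * (\<Prod>i<m. y R i ^ p i))" for p
    proof -
      have "(\<Prod>i<m. 2 * cosh ((?c + real (p i)) * \<theta> i)) = (\<Prod>i<m. exp (- ((?c + real (p i)) * \<theta> i)) + exp ((?c + real (p i)) * \<theta> i))"
        by (intro prod.cong refl) (simp add: cosh_def)
      also have "\<dots> = (\<Sum>R\<in>Pow ?I. (\<Prod>i\<in>R. exp (- ((?c + real (p i)) * \<theta> i))) * (\<Prod>i\<in>?I - R. exp ((?c + real (p i)) * \<theta> i)))"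
        by (rule prod_add) simp
      also have "\<dots> = (\<Sum>R\<in>Pow ?I. (\<Prod>i\<in>?I. if i \<in> R then exp (- ((?c + real (p i)) * \<theta> i)) else exp ((?c + real (p i)) * \<theta> i)))"
        by (intro sum.cong refl) (auto simp: prod.If_cases Int_absorb1 Diff_eq)
      also have "\<dots> = (\<Sum>R\<in>Pow ?I. (\<Prod>i\<in>?I. exp (?c * \<phi> R i) * y R i ^ p i))"
      proof (intro sum.cong prod.cong refl)
        fix R i
        have "exp (?c * \<phi> R i) * y R i ^ p i = exp ((?c + real (p i)) * \<phi> R i)"
          by (simp add: y_def exp_of_nat_mult[symmetric] exp_add[symmetric] algebra_simps)
        then show "(if i \<in> R then exp (- ((?c + real (p i)) * \<theta> i)) else exp ((?c + real (p i)) * \<theta> i)) = exp (?c * \<phi> R i) * y R i ^ p i"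
          by (simp add: \<phi>_def)
      qed
      finally show ?thesis by (simp add: prod.distrib)
    qed
    have "matrix_det m (\<lambda>i j. 2 * cosh ((?c + real j) * \<theta> i)) =
      (\<Sum>p | p permutes ?I. \<Sum>R\<in>Pow ?I. of_int (sign p) * ((\<Prod>i<m. exp (?c * \<phi> R i)) * (\<Prod>i<m. y R i ^ p i)))"
      by (simp only: matrix_det_leibniz pr sum_distrib_left)
    also have "\<dots> = (\<Sum>R\<in>Pow ?I. \<Sum>p | p permutes ?I. of_int (sign p) * ((\<Prod>i<m. exp (?c * \<phi> R i)) * (\<Prod>i<m. y R i ^ p i)))"
      by (rule sum.swap)
    also have "\<dots> = (\<Sum>R\<in>Pow ?I. (\<Prod>i<m. exp (?c * \<phi> R i)) * matrix_det m (\<lambda>i j. y R i ^ j))"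
      unfolding matrix_det_leibniz sum_distrib_left by (intro sum.cong refl) (simp only: mult_ac)
    finally show ?thesis by (simp only: vandermonde_det mult.commute)
  qed
  have "alternant_sum (\<lambda>i a. 2 * cosh (real a * \<theta> i)) ?u n ?I =
     (\<Sum>R\<in>Pow ?I. pair_prod (\<lambda>i j. 1 / (1 - 1 / (y R i * y R j))) ?I * alternant_sum (\<lambda>i a. y R i ^ a) (y R) n ?I)"
    using alternant_sum_symmetric[of ?I "\<lambda>i. exp (\<theta> i)" n] by (simp add: inv pw ch)
  also have "\<dots> = (\<Sum>R\<in>Pow ?I. (pair_prod (\<lambda>i j. 1 / (1 - 1 / (y R i * y R j))) ?I / pair_prod (\<lambda>i j. (y R j - y R i) * (1 - y R i * y R j)) ?I)
      * (matrix_det m (\<lambda>i j. y R i ^ j - (1 / y R i) ^ j * y R i ^ N) / (\<Prod>i<m. 1 - y R i)))"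
    using gen by (simp add: alternant_sum_powers cut_sum_det N_def mult_ac)
  also have "\<dots> = (\<Sum>R\<in>Pow ?I. (pair_prod (\<lambda>i j. y R j - y R i) ?I * (\<Prod>i<m. exp (?c * \<phi> R i))) *
      (pair_prod (\<lambda>i j. -1) ?I * ?S / (?D\<^sup>2 * (\<Prod>i<m. 2 * sinh (\<theta> i / 2)))))"
  proof (rule sum.cong[OF refl])
    fix R
    have alg: "s * a * e / d * (f * S / h) = (a * (e * f)) * (s * S / (d * h))" for s a e d f S h :: real
      by simp
    have e: "(\<Prod>i<m. exp (- (real m - 1) * \<phi> R i)) * (\<Prod>i<m. exp ((real N - 1) / 2 * \<phi> R i)) = (\<Prod>i<m. exp (?c * \<phi> R i))"
      unfolding prod.distrib[symmetric] exp_add[symmetric] distrib_right[symmetric] rN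
      by (intro prod.cong refl arg_cong[of _ _ exp] arg_cong2[of _ _ _ _ "(*)"]) (simp add: field_simps)
    show "(pair_prod (\<lambda>i j. 1 / (1 - 1 / (y R i * y R j))) ?I / pair_prod (\<lambda>i j. (y R j - y R i) * (1 - y R i * y R j)) ?I)
      * (matrix_det m (\<lambda>i j. y R i ^ j - (1 / y R i) ^ j * y R i ^ N) / (\<Prod>i<m. 1 - y R i)) =
      (pair_prod (\<lambda>i j. y R j - y R i) ?I * (\<Prod>i<m. exp (?c * \<phi> R i))) *
      (pair_prod (\<lambda>i j. -1) ?I * ?S / (?D\<^sup>2 * (\<Prod>i<m. 2 * sinh (\<theta> i / 2))))"
      unfolding pairs rows alg e ..
  qed
  also have "\<dots> = matrix_det m (\<lambda>i j. 2 * cosh ((?c + real j) * \<theta> i)) * (pair_prod (\<lambda>i j. -1) ?I * ?S / (?D\<^sup>2 * (\<Prod>i<m. 2 * sinh (\<theta> i / 2))))"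
    unfolding sum_distrib_right[symmetric] Csum ..
  finally have main: "alternant_sum (\<lambda>i a. 2 * cosh (real a * \<theta> i)) ?u n ?I = \<dots>" .
  have "?D \<noteq> 0" using une by (intro pair_prod_nonzero) (auto simp del: mult_cancel_left)
  moreover have "(\<Prod>i<m. 2 * sinh (\<theta> i / 2)) \<noteq> 0" using pos by (force simp: sinh_real_zero_iff)
  ultimately show ?thesis unfolding main rN by (simp add: field_simps)
qed

section \<open>Normalised sums of alternants as sums of determinants\<close>


lemma pair_prod_lessThan_Suc_shift:
  "pair_prod f {..<Suc n} = (\<Prod>j<n. f 0 (Suc j)) * pair_prod (\<lambda>i j. f (Suc i) (Suc j)) {..<n}"
proof -
  let ?f = "\<lambda>i j. if i < j then f i j else if j < i then f j i else 1"
  have sym: "?f i j = ?f j i" for i j by auto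
  have "pair_prod f {..<Suc n} = pair_prod ?f (insert 0 (Suc ` {..<n}))"
    unfolding lessThan_Suc_eq_insert_0 by (rule pair_prod_cong) auto
  also have "\<dots> = pair_prod ?f (Suc ` {..<n}) * (\<Prod>j\<in>Suc ` {..<n}. ?f 0 j)"
    by (rule pair_prod_insert) auto
  also have "(\<Prod>j\<in>Suc ` {..<n}. ?f 0 j) = (\<Prod>j<n. f 0 (Suc j))"
    by (simp add: prod.reindex)
  also have "pair_prod ?f (Suc ` {..<n}) = pair_prod (\<lambda>i j. ?f (Suc i) (Suc j)) {..<n}"
    by (rule pair_prod_reindex) auto
  also have "\<dots> = pair_prod (\<lambda>i j. f (Suc i) (Suc j)) {..<n}"
    by (rule pair_prod_cong) auto
  finally show ?thesis by (simp add: mult.commute)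
qed

text \<open>
  The Vandermonde product along a list changes by the sign of the permutation when the list is
  permuted, and thereby replaces the sign in the Leibniz formula.
\<close>
fun diff_prod :: "('i \<Rightarrow> real) \<Rightarrow> 'i list \<Rightarrow> real" where
  "diff_prod u [] = 1"
| "diff_prod u (z # zs) = (\<Prod>w\<in>set zs. u z - u w) * diff_prod u zs"

text \<open>
  The sum over all strictly decreasing sequences of exponents below n, matched with the entries of
  the list (see \<open>descending_sum_subsets\<close> below).
\<close>
fun descending_sum :: "('i \<Rightarrow> nat \<Rightarrow> real) \<Rightarrow> nat \<Rightarrow> 'i list \<Rightarrow> real" where
  "descending_sum g 0 zs = (if zs = [] then 1 else 0)"
| "descending_sum g (Suc n) [] = 1"
| "descending_sum g (Suc n) (z # zs) = descending_sum g n (z # zs) + g z n * descending_sum g n zs"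

lemma sum_permutations_of_set:
  assumes "finite I" "I \<noteq> {}"
  shows "(\<Sum>zs\<in>permutations_of_set I. F zs) = (\<Sum>z\<in>I. \<Sum>zs\<in>permutations_of_set (I - {z}). F (z # zs))"
  unfolding permutations_of_set_nonempty[OF assms(2)]
  using assms by (subst sum.UNION_disjoint) (auto simp: sum.reindex inj_on_def)

text \<open>
  The first entry of the list is the row that is paired with the largest exponent.
\<close>
lemma alternant_sum_permutations:
  assumes "finite I"
  shows "alternant_sum g u n I = (\<Sum>zs\<in>permutations_of_set I. descending_sum g n zs / diff_prod u zs)"
  using assms
proof (induction n arbitrary: I)
  case 0
  have "(\<Sum>zs\<in>permutations_of_set I. descending_sum g 0 zs / diff_prod u zs) = 0" if "I \<noteq> {}"
    by (rule sum.neutral) (use that in \<open>auto dest: permutations_of_setD\<close>)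
  then show ?case by auto
next
  case (Suc n)
  show ?case
  proof (cases "I = {}")
    case True
    then show ?thesis using Suc.IH[of "{}"] by (cases n) auto
  next
    case False
    have set: "set zs = I - {z}" if "zs \<in> permutations_of_set (I - {z})" for zs z
      using permutations_of_setD[OF that] by simp
    have "(\<Sum>zs\<in>permutations_of_set I. descending_sum g (Suc n) zs / diff_prod u zs) =
      (\<Sum>z\<in>I. \<Sum>zs\<in>permutations_of_set (I - {z}). descending_sum g n (z # zs) / diff_prod u (z # zs) +
          g z n * (descending_sum g n zs / diff_prod u zs) / (\<Prod>w\<in>I - {z}. u z - u w))"
      unfolding sum_permutations_of_set[OF Suc.prems False]
      by (intro sum.cong refl) (simp add: set add_divide_distrib mult.commute)
    also have "\<dots> = (\<Sum>zs\<in>permutations_of_set I. descending_sum g n zs / diff_prod u zs) +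
       (\<Sum>z\<in>I. g z n * (\<Sum>zs\<in>permutations_of_set (I - {z}). descending_sum g n zs / diff_prod u zs) / (\<Prod>w\<in>I - {z}. u z - u w))"
      unfolding sum_permutations_of_set[OF Suc.prems False]
      by (simp add: sum.distrib sum_distrib_left sum_divide_distrib)
    also have "\<dots> = alternant_sum g u (Suc n) I"
      using Suc.prems by (simp add: Suc.IH)
    finally show ?thesis by simp
  qed
qed

definition desc_list :: "nat set \<Rightarrow> nat list" where
  "desc_list A = rev (sorted_list_of_set A)"

lemma desc_list:
  assumes "finite A"
  shows "length (desc_list A) = card A" "set (desc_list A) = A"
    "i < j \<Longrightarrow> j < card A \<Longrightarrow> desc_list A ! j < desc_list A ! i"
proof -
  show "length (desc_list A) = card A" "set (desc_list A) = A"
    using assms by (auto simp: desc_list_def)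
  have "sorted_wrt (>) (desc_list A)"
    unfolding desc_list_def sorted_wrt_rev using strict_sorted_list_of_set[of A] by simp
  then show "desc_list A ! j < desc_list A ! i" if "i < j" "j < card A"
    using that assms sorted_wrt_nth_less[of "(>)" "desc_list A" i j] by (simp add: desc_list_def)
qed

lemma desc_list_bij:
  assumes "finite A"
  shows "bij_betw (\<lambda>j. desc_list A ! j) {..<card A} A"
  using bij_betw_nth[of "desc_list A"] assms desc_list[OF assms] by (simp add: desc_list_def)

lemma desc_list_insert:
  assumes "A \<subseteq> {..<n}"
  shows "desc_list (insert n A) = n # desc_list A"
proof -
  have fin: "finite A" using assms finite_subset by blast
  have nA: "n \<notin> A" using assms by auto
  have "sorted_list_of_set (insert n A) = sorted_list_of_set A @ [n]"
    using assms fin nA sorted_list_of_set.idem_if_sorted_distinct[of "sorted_list_of_set A @ [n]"]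
    by (auto simp: sorted_append less_imp_le subset_iff)
  then show ?thesis by (simp add: desc_list_def)
qed

lemma subsets_lessThan_Suc:
  "{A. A \<subseteq> {..<Suc n} \<and> card A = Suc k} =
    {A. A \<subseteq> {..<n} \<and> card A = Suc k} \<union> insert n ` {A. A \<subseteq> {..<n} \<and> card A = k}"
proof (intro equalityI subsetI)
  fix A assume A: "A \<in> {A. A \<subseteq> {..<Suc n} \<and> card A = Suc k}"
  then have fin: "finite A" using finite_subset by blast
  show "A \<in> {A. A \<subseteq> {..<n} \<and> card A = Suc k} \<union> insert n ` {A. A \<subseteq> {..<n} \<and> card A = k}"
  proof (cases "n \<in> A")
    case True
    then have "A = insert n (A - {n})" "A - {n} \<subseteq> {..<n}" "card (A - {n}) = k"
      using A fin by (auto simp: less_Suc_eq)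
    then show ?thesis by blast
  next
    case False
    then show ?thesis using A by (auto simp: less_Suc_eq)
  qed
next
  fix A assume "A \<in> {A. A \<subseteq> {..<n} \<and> card A = Suc k} \<union> insert n ` {A. A \<subseteq> {..<n} \<and> card A = k}"
  then show "A \<in> {A. A \<subseteq> {..<Suc n} \<and> card A = Suc k}"
  proof (elim UnE imageE)
    fix B assume "A = insert n B" and B: "B \<in> {A. A \<subseteq> {..<n} \<and> card A = k}"
    moreover have "finite B" "n \<notin> B" using B finite_subset[of B "{..<n}"] by auto
    ultimately show ?thesis by (auto simp: less_Suc_eq)
  qed (auto simp: less_Suc_eq)
qed

lemma descending_sum_subsets:
  "descending_sum g n zs =
     (\<Sum>A | A \<subseteq> {..<n} \<and> card A = length zs. \<Prod>k<length zs. g (zs ! k) (desc_list A ! k))"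
proof (induction n arbitrary: zs)
  case 0
  have "{A. A \<subseteq> {..<0::nat} \<and> card A = length zs} = (if zs = [] then {{}} else {})" by auto
  then show ?case by simp
next
  case (Suc n)
  show ?case
  proof (cases zs)
    case Nil
    have empty: "{A. A \<subseteq> {..<Suc n} \<and> card A = 0} = {{}}"
    proof (intro equalityI subsetI)
      fix A assume A: "A \<in> {A. A \<subseteq> {..<Suc n} \<and> card A = 0}"
      then have "finite A" using finite_subset[of A "{..<Suc n}"] by simp
      then show "A \<in> {{}}" using A by simp
    qed simp
    show ?thesis unfolding Nil list.size(3) empty by simp
  next
    case (Cons z ws)
    let ?S = "\<lambda>(n::nat) k. {A. A \<subseteq> {..<n} \<and> card A = k}"
    let ?F = "\<lambda>zs A. \<Prod>k<length zs. g (zs ! k) (desc_list A ! k)"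
    have fin: "finite (?S n k)" for n k by (rule finite_subset[of _ "Pow {..<n}"]) auto
    have notin: "n \<notin> A" if "A \<in> ?S n k" for A k using that by auto
    have inj: "inj_on (insert n) (?S n (length ws))"
      by (rule inj_onI) (metis notin insert_ident)
    have "?S (Suc n) (length zs) = ?S n (length zs) \<union> insert n ` ?S n (length ws)"
      unfolding Cons length_Cons by (rule subsets_lessThan_Suc)
    moreover have "?S n (length zs) \<inter> insert n ` ?S n (length ws) = {}"
      using notin by blast
    ultimately have "(\<Sum>A\<in>?S (Suc n) (length zs). ?F zs A) =
      (\<Sum>A\<in>?S n (length zs). ?F zs A) + (\<Sum>A\<in>insert n ` ?S n (length ws). ?F zs A)"
      by (simp only: sum.union_disjoint[OF fin finite_imageI[OF fin]])
    also have "(\<Sum>A\<in>insert n ` ?S n (length ws). ?F zs A) = (\<Sum>A\<in>?S n (length ws). ?F zs (insert n A))"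
      by (simp only: sum.reindex[OF inj] comp_def)
    also have "\<dots> = (\<Sum>A\<in>?S n (length ws). g z n * ?F ws A)"
      unfolding Cons length_Cons
      by (intro sum.cong refl) (subst prod.lessThan_Suc_shift, auto simp: desc_list_insert)
    finally show ?thesis
      using Suc.IH[of zs] Suc.IH[of ws] Cons by (simp add: sum_distrib_left)
  qed
qed

lemma diff_prod_eq_pair_prod:
  assumes "distinct zs"
  shows "diff_prod u zs = pair_prod (\<lambda>i j. u (zs ! i) - u (zs ! j)) {..<length zs}"
  using assms
proof (induction zs)
  case (Cons z zs)
  have "(\<Prod>w\<in>set zs. u z - u w) = (\<Prod>j<length zs. u z - u (zs ! j))"
    using Cons.prems bij_betw_nth[of zs "{..<length zs}" "set zs"]
    by (intro prod.reindex_bij_betw[symmetric]) simp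
  then show ?case using Cons by (simp add: pair_prod_lessThan_Suc_shift)
qed simp

lemma bij_permutes_permutations:
  "bij_betw (\<lambda>p. map p [0..<m]) {p. p permutes {..<m}} (permutations_of_set {..<m})"
proof (rule bij_betw_imageI)
  show "inj_on (\<lambda>p. map p [0..<m]) {p. p permutes {..<m}}"
  proof (rule inj_onI)
    fix p q assume p: "p \<in> {p. p permutes {..<m}}" and q: "q \<in> {p. p permutes {..<m}}"
      and eq: "map p [0..<m] = map q [0..<m]"
    show "p = q"
    proof
      fix i
      show "p i = q i"
      proof (cases "i < m")
        case True
        then show ?thesis using eq by (auto simp: map_eq_conv)
      next
        case False
        then show ?thesis using p q by (simp add: permutes_not_in)
      qed
    qed
  qed
  show "(\<lambda>p. map p [0..<m]) ` {p. p permutes {..<m}} = permutations_of_set {..<m}"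
  proof (intro equalityI subsetI)
    fix zs assume "zs \<in> (\<lambda>p. map p [0..<m]) ` {p. p permutes {..<m}}"
    then obtain p where p: "p permutes {..<m}" and zs: "zs = map p [0..<m]" by auto
    show "zs \<in> permutations_of_set {..<m}"
      using permutes_image[OF p] permutes_inj_on[OF p, of "{0..<m}"]
      by (auto simp: zs permutations_of_set_def distinct_map atLeast0LessThan)
  next
    fix zs assume zs: "zs \<in> permutations_of_set {..<m}"
    then have d: "distinct zs" "set zs = {..<m}" and len: "length zs = m"
      using length_finite_permutations_of_set[OF zs] by (auto dest: permutations_of_setD)
    define p where "p i = (if i < m then zs ! i else i)" for i
    have "bij_betw ((!) zs) {..<m} {..<m}"
      by (rule bij_betw_nth[OF d(1)]) (simp_all only: d(2) len)
    then have "bij_betw p {..<m} {..<m}"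
      by (subst bij_betw_cong[of _ _ "(!) zs"]) (simp_all add: p_def)
    then have "p permutes {..<m}" by (rule bij_imp_permutes) (simp add: p_def)
    moreover have "zs = map p [0..<m]" using len by (intro nth_equalityI) (simp_all add: p_def)
    ultimately show "zs \<in> (\<lambda>p. map p [0..<m]) ` {p. p permutes {..<m}}" by blast
  qed
qed

text \<open>
  The lists enumerating the index set correspond to its permutations, and the Vandermonde products
  supply the signs of the Leibniz formula.
\<close>
theorem alternant_sum_eq_sum_det:
  assumes inj: "inj_on u {..<m}"
  shows "alternant_sum g u n {..<m} * pair_prod (\<lambda>i j. u i - u j) {..<m} =
    (\<Sum>A | A \<subseteq> {..<n} \<and> card A = m. matrix_det m (\<lambda>j i. g i (desc_list A ! j)))"
proof -
  let ?D = "pair_prod (\<lambda>i j. u i - u j) {..<m}"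
  have D: "?D \<noteq> 0" using inj by (intro pair_prod_nonzero) (auto simp: inj_on_def)
  have "alternant_sum g u n {..<m} = (\<Sum>p | p permutes {..<m}. descending_sum g n (map p [0..<m]) / diff_prod u (map p [0..<m]))"
    unfolding alternant_sum_permutations[OF finite_lessThan]
    by (rule sum.reindex_bij_betw[OF bij_permutes_permutations, symmetric])
  also have "\<dots> = (\<Sum>p | p permutes {..<m}. of_int (sign p) * (\<Sum>A | A \<subseteq> {..<n} \<and> card A = m. \<Prod>k<m. g (p k) (desc_list A ! k)) / ?D)"
  proof (rule sum.cong[OF refl])
    fix p assume "p \<in> {p. p permutes {..<m}}"
    then have p: "p permutes {..<m}" by simp
    have "distinct (map p [0..<m])"
      using permutes_inj_on[OF p, of "{0..<m}"] by (simp add: distinct_map)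
    then have "diff_prod u (map p [0..<m]) = pair_prod (\<lambda>i j. u (p i) - u (p j)) {..<m}"
      by (simp add: diff_prod_eq_pair_prod) (rule pair_prod_cong, simp)
    also have "\<dots> = of_int (sign p) * ?D"
      using vandermonde_permute[OF p, of "\<lambda>i. - u i"] by simp
    finally have d: "diff_prod u (map p [0..<m]) = of_int (sign p) * ?D" .
    have "(\<Sum>A | A \<subseteq> {..<n} \<and> card A = length (map p [0..<m]). \<Prod>k<length (map p [0..<m]). g (map p [0..<m] ! k) (desc_list A ! k))
      = (\<Sum>A | A \<subseteq> {..<n} \<and> card A = m. \<Prod>k<m. g (p k) (desc_list A ! k))"
      by simp
    then show "descending_sum g n (map p [0..<m]) / diff_prod u (map p [0..<m]) =
      of_int (sign p) * (\<Sum>A | A \<subseteq> {..<n} \<and> card A = m. \<Prod>k<m. g (p k) (desc_list A ! k)) / ?D"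
      unfolding descending_sum_subsets d by (cases p rule: sign_cases) simp_all
  qed
  also have "\<dots> = (\<Sum>A | A \<subseteq> {..<n} \<and> card A = m. matrix_det m (\<lambda>j i. g i (desc_list A ! j))) / ?D"
    unfolding matrix_det_leibniz sum_divide_distrib[symmetric] sum_distrib_left
    by (subst sum.swap) simp
  finally show ?thesis using D by simp
qed

section \<open>Sums of Vandermonde products of squares\<close>

text \<open>
  Chebyshev polynomials of the third and fourth kind, normalised to be monic in 2 cosh z: the
  quotients of cosh ((i + 1/2) z) by cosh (z / 2) for e = -1, and of the hyperbolic sines for e = 1.
\<close>
fun half_poly :: "real \<Rightarrow> nat \<Rightarrow> real poly" where
  "half_poly e 0 = 1"
| "half_poly e (Suc 0) = [:e, 1:]"
| "half_poly e (Suc (Suc i)) = [:0, 1:] * half_poly e (Suc i) - half_poly e i"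

lemma half_poly_monic: "degree (half_poly e i) = i" "lead_coeff (half_poly e i) = 1"
proof -
  have *: "degree (half_poly e i) \<le> i \<and> coeff (half_poly e i) i = 1" for i
  proof (induction e i rule: half_poly.induct)
    case (3 e i)
    have "degree (half_poly e i) < Suc (Suc i)" using "3.IH"(2) by simp
    then have "coeff (half_poly e i) (Suc (Suc i)) = 0" by (rule coeff_eq_0)
    moreover have "degree ([:0, 1:] * half_poly e (Suc i) - half_poly e i) \<le> Suc (Suc i)"
      using "3.IH" by (intro degree_diff_le) (auto intro!: order_trans[OF degree_pCons_le])
    ultimately show ?case using "3.IH"(1) by simp
  qed auto
  have "i \<le> degree (half_poly e i)" using *[of i] by (intro le_degree) simp
  then show "degree (half_poly e i) = i" using *[of i] by linarith
  then show "lead_coeff (half_poly e i) = 1" using *[of i] by simp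
qed

lemma cosh_half_poly: "2 * cosh ((real i + 1 / 2) * z) = 2 * cosh (z / 2) * poly (half_poly (-1) i) (2 * cosh z)"
proof (induction "-1 :: real" i rule: half_poly.induct)
  case 2
  have "cosh (3 / 2 * z) = 2 * cosh z * cosh (z / 2) - cosh (z / 2)"
    using cosh_add[of z "z / 2"] cosh_diff[of z "z / 2"] by (simp add: field_simps)
  then show ?case by (simp add: algebra_simps)
next
  case (3 i)
  have "cosh ((real i + 5 / 2) * z) = 2 * cosh z * cosh ((real i + 3 / 2) * z) - cosh ((real i + 1 / 2) * z)"
    using cosh_add[of "(real i + 3 / 2) * z" z] cosh_diff[of "(real i + 3 / 2) * z" z] by (simp add: algebra_simps)
  then have "2 * cosh ((real i + 5 / 2) * z) = 2 * cosh z * (2 * cosh ((real i + 3 / 2) * z)) - 2 * cosh ((real i + 1 / 2) * z)"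
    by simp
  with 3 show ?case by (simp add: algebra_simps)
qed simp

lemma sinh_half_poly: "2 * sinh ((real i + 1 / 2) * z) = 2 * sinh (z / 2) * poly (half_poly 1 i) (2 * cosh z)"
proof (induction "1 :: real" i rule: half_poly.induct)
  case 2
  have "sinh (3 / 2 * z) = 2 * cosh z * sinh (z / 2) + sinh (z / 2)"
    using sinh_add[of z "z / 2"] sinh_diff[of z "z / 2"] by (simp add: field_simps)
  then show ?case by (simp add: algebra_simps)
next
  case (3 i)
  have "sinh ((real i + 5 / 2) * z) = 2 * cosh z * sinh ((real i + 3 / 2) * z) - sinh ((real i + 1 / 2) * z)"
    using sinh_add[of "(real i + 3 / 2) * z" z] sinh_diff[of "(real i + 3 / 2) * z" z] by (simp add: algebra_simps)
  then have "2 * sinh ((real i + 5 / 2) * z) = 2 * cosh z * (2 * sinh ((real i + 3 / 2) * z)) - 2 * sinh ((real i + 1 / 2) * z)"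
    by simp
  with 3 show ?case by (simp add: algebra_simps)
qed simp

lemma det_cosh:
  "matrix_det m (\<lambda>i j. 2 * cosh (c j * ((real i + 1 / 2) * t))) =
    (\<Prod>j<m. 2 * cosh (c j * t / 2)) * pair_prod (\<lambda>i j. 2 * cosh (c j * t) - 2 * cosh (c i * t)) {..<m}"
proof -
  have "2 * cosh (c j * ((real i + 1 / 2) * t)) = 2 * cosh (c j * t / 2) * poly (half_poly (-1) i) (2 * cosh (c j * t))" for i j
    using cosh_half_poly[of i "c j * t"] by (simp add: mult_ac)
  then show ?thesis
    by (simp only: matrix_det_col_scale det_monic_poly[where P = "half_poly (-1)", OF half_poly_monic(1) half_poly_monic(2)])
qed

lemma det_sinh:
  "matrix_det m (\<lambda>i j. 2 * sinh (c j * ((real i + 1 / 2) * t))) =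
    (\<Prod>j<m. 2 * sinh (c j * t / 2)) * pair_prod (\<lambda>i j. 2 * cosh (c j * t) - 2 * cosh (c i * t)) {..<m}"
proof -
  have "2 * sinh (c j * ((real i + 1 / 2) * t)) = 2 * sinh (c j * t / 2) * poly (half_poly 1 i) (2 * cosh (c j * t))" for i j
    using sinh_half_poly[of i "c j * t"] by (simp add: mult_ac)
  then show ?thesis
    by (simp only: matrix_det_col_scale det_monic_poly[where P = "half_poly 1", OF half_poly_monic(1) half_poly_monic(2)])
qed

abbreviation vdm :: "('i::linorder \<Rightarrow> real) \<Rightarrow> 'i set \<Rightarrow> real" where
  "vdm f A \<equiv> pair_prod (\<lambda>a b. \<bar>f b - f a\<bar>) A"

lemma matrix_det_transpose: "matrix_det m (\<lambda>i j. f j i) = matrix_det m f"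
  by (subst Determinant.det_transpose[of _ m, symmetric]) (auto intro!: arg_cong[of _ _ Determinant.det])

text \<open>
  At the angles (i + 1/2) t the roles of rows and columns in the determinants can be exchanged: the
  entries are, up to a factor for each column, monic polynomials of degree i evaluated at a node given
  by the column. Passing to
  absolute values at the end avoids a comparison of the signs that stem from the order of the nodes.
\<close>
theorem sum_vdm_cosh:
  assumes t: "t > 0" and mn: "m \<le> n"
  shows "(\<Sum>A | A \<subseteq> {..<n} \<and> card A = m. (\<Prod>a\<in>A. 2 * cosh (real a * t / 2)) * vdm (\<lambda>a. 2 * cosh (real a * t)) A) *
      vdm (\<lambda>i. 2 * cosh ((real i + 1 / 2) * t)) {..<m} * (\<Prod>i<m. 2 * sinh ((real i + 1 / 2) * t / 2)) =
    (\<Prod>j<m. 2 * sinh (((real n + real m - 1) / 2 - real j) * t / 2)) *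
      vdm (\<lambda>j. 2 * cosh (((real n + real m - 1) / 2 - real j) * t)) {..<m} *
    ((\<Prod>j<m. 2 * cosh (((real n - real m) / 2 + real j) * t / 2)) *
      vdm (\<lambda>j. 2 * cosh (((real n - real m) / 2 + real j) * t)) {..<m})"
proof -
  let ?I = "{..<m}" and ?P = "{A. A \<subseteq> {..<n} \<and> card A = m}"
  define \<theta> where "\<theta> i = (real i + 1 / 2) * t" for i
  define u where "u i = 2 * cosh (\<theta> i)" for i
  define \<tau> where "\<tau> = alternant_sum (\<lambda>i a. 2 * cosh (real a * \<theta> i)) u n ?I"
  define s where "s = pair_prod (\<lambda>i j. -1 :: real) ?I"
  define D where "D = pair_prod (\<lambda>i j. u j - u i) ?I"
  define W where "W A = (\<Prod>a\<in>A. 2 * cosh (real a * t / 2)) * vdm (\<lambda>a. 2 * cosh (real a * t)) A" for A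
  let ?l = "\<lambda>j. (real n + real m - 1) / 2 - real j" and ?k = "\<lambda>j. (real n - real m) / 2 + real j"
  let ?S = "matrix_det m (\<lambda>i j. 2 * sinh (?l j * \<theta> i))" and ?C = "matrix_det m (\<lambda>i j. 2 * cosh (?k j * \<theta> i))"
  have pos: "\<theta> i > 0" for i using t by (simp add: \<theta>_def)
  have inj: "inj_on \<theta> ?I" using t by (auto simp: \<theta>_def inj_on_def)
  have "inj_on u ?I"
  proof (rule inj_onI)
    fix i j assume ij: "i \<in> ?I" "j \<in> ?I" "u i = u j"
    then have "cosh (\<theta> i) = cosh (\<theta> j)" by (simp add: u_def)
    then have "\<theta> i = \<theta> j"
      using pos[of i] pos[of j] cosh_real_strict_mono[of "\<theta> i" "\<theta> j"] cosh_real_strict_mono[of "\<theta> j" "\<theta> i"]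
      by (metis less_imp_le less_irrefl linorder_neqE_linordered_idom)
    then show "i = j" using inj ij by (auto simp: inj_on_def)
  qed
  have s: "s * s = 1" "\<bar>s\<bar> = 1"
  proof -
    show "\<bar>s\<bar> = 1" by (simp add: s_def pair_prod_abs) (simp add: pair_prod_def)
    then show "s * s = 1" by (metis abs_mult_self_eq mult_1)
  qed
  have detA: "matrix_det m (\<lambda>j i. 2 * cosh (real (desc_list A ! j) * \<theta> i)) = s * W A" if A: "A \<in> ?P" for A
  proof -
    have fin: "finite A" and card: "card A = m" using A finite_subset by auto
    let ?h = "\<lambda>j. desc_list A ! j"
    have bij: "bij_betw ?h ?I A" using desc_list_bij[OF fin] card by simp
    have "matrix_det m (\<lambda>j i. 2 * cosh (real (?h j) * \<theta> i)) = matrix_det m (\<lambda>i j. 2 * cosh (real (?h j) * \<theta> i))"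
      by (rule matrix_det_transpose)
    also have "\<dots> = (\<Prod>j<m. 2 * cosh (real (?h j) * t / 2)) * pair_prod (\<lambda>i j. 2 * cosh (real (?h j) * t) - 2 * cosh (real (?h i) * t)) ?I"
      unfolding \<theta>_def by (rule det_cosh)
    also have "pair_prod (\<lambda>i j. 2 * cosh (real (?h j) * t) - 2 * cosh (real (?h i) * t)) ?I =
      pair_prod (\<lambda>i j. -1 * \<bar>2 * cosh (real (?h j) * t) - 2 * cosh (real (?h i) * t)\<bar>) ?I"
    proof (rule pair_prod_cong)
      fix i j assume "i \<in> ?I" "j \<in> ?I" "i < j"
      then have "?h j < ?h i" using desc_list(3)[OF fin, of i j] card by simp
      then have "cosh (real (?h j) * t) < cosh (real (?h i) * t)"
        using t by (intro cosh_real_strict_mono) auto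
      then show "2 * cosh (real (?h j) * t) - 2 * cosh (real (?h i) * t) = -1 * \<bar>2 * cosh (real (?h j) * t) - 2 * cosh (real (?h i) * t)\<bar>"
        by simp
    qed
    also have "\<dots> = s * pair_prod (\<lambda>i j. \<bar>2 * cosh (real (?h j) * t) - 2 * cosh (real (?h i) * t)\<bar>) ?I"
      unfolding s_def by (rule pair_prod_mult)
    also have "pair_prod (\<lambda>i j. \<bar>2 * cosh (real (?h j) * t) - 2 * cosh (real (?h i) * t)\<bar>) ?I = vdm (\<lambda>a. 2 * cosh (real a * t)) (?h ` ?I)"
      using bij by (intro pair_prod_reindex[symmetric]) (auto simp: bij_betw_def abs_minus_commute)
    also have "?h ` ?I = A" using bij by (simp add: bij_betw_def)
    also have "(\<Prod>j<m. 2 * cosh (real (?h j) * t / 2)) = (\<Prod>a\<in>A. 2 * cosh (real a * t / 2))"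
      by (rule prod.reindex_bij_betw[OF bij])
    finally show ?thesis by (simp add: W_def mult_ac)
  qed
  have "\<tau> * pair_prod (\<lambda>i j. -1 * (u j - u i)) ?I = (\<Sum>A\<in>?P. s * W A)"
    using alternant_sum_eq_sum_det[OF \<open>inj_on u ?I\<close>, of "\<lambda>i a. 2 * cosh (real a * \<theta> i)" n] detA
    by (simp add: \<tau>_def)
  then have "\<tau> * (s * D) = s * (\<Sum>A\<in>?P. W A)"
    unfolding pair_prod_mult s_def D_def by (simp add: sum_distrib_left)
  then have "(s * s) * (\<tau> * D) = (s * s) * (\<Sum>A\<in>?P. W A)" by (metis mult.assoc mult.left_commute)
  then have tD: "\<tau> * D = (\<Sum>A\<in>?P. W A)" by (simp add: s)
  have "\<tau> * D\<^sup>2 * (\<Prod>i<m. 2 * sinh (\<theta> i / 2)) = s * ?S * ?C"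
    unfolding \<tau>_def D_def s_def u_def by (rule alternant_sum_cosh) (use pos inj in auto)
  then have "(\<Sum>A\<in>?P. W A) * D * (\<Prod>i<m. 2 * sinh (\<theta> i / 2)) = s * ?S * ?C"
    unfolding tD[symmetric] by (simp add: power2_eq_square mult_ac)
  then have "\<bar>(\<Sum>A\<in>?P. W A) * D * (\<Prod>i<m. 2 * sinh (\<theta> i / 2))\<bar> = \<bar>?S\<bar> * \<bar>?C\<bar>"
    by (simp add: abs_mult s)
  moreover have "W A \<ge> 0" for A
    unfolding W_def pair_prod_def by (intro mult_nonneg_nonneg prod_nonneg) auto
  then have "\<bar>\<Sum>A\<in>?P. W A\<bar> = (\<Sum>A\<in>?P. W A)" by (intro abs_of_nonneg sum_nonneg) auto
  moreover have "(\<Prod>i<m. 2 * sinh (\<theta> i / 2)) \<ge> 0" using pos by (intro prod_nonneg) (auto simp: less_imp_le)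
  ultimately have "(\<Sum>A\<in>?P. W A) * \<bar>D\<bar> * (\<Prod>i<m. 2 * sinh (\<theta> i / 2)) = \<bar>?S\<bar> * \<bar>?C\<bar>"
    by (simp add: abs_mult)
  moreover have "\<bar>?S\<bar> = (\<Prod>j<m. 2 * sinh (?l j * t / 2)) * vdm (\<lambda>j. 2 * cosh (?l j * t)) ?I"
  proof -
    have "2 * sinh (?l j * t / 2) \<ge> 0" if "j < m" for j
    proof -
      have "real j + 1 \<le> real m" "real m \<le> real n" using that mn by simp_all
      then have "?l j \<ge> 0" by simp
      then have "?l j * t / 2 \<ge> 0" using t by simp
      then show ?thesis by simp
    qed
    then have "(\<Prod>j<m. 2 * sinh (?l j * t / 2)) \<ge> 0" by (intro prod_nonneg) auto
    then show ?thesis unfolding \<theta>_def det_sinh abs_mult pair_prod_abs by simp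
  qed
  moreover have "\<bar>?C\<bar> = (\<Prod>j<m. 2 * cosh (?k j * t / 2)) * vdm (\<lambda>j. 2 * cosh (?k j * t)) ?I"
  proof -
    have "(\<Prod>j<m. 2 * cosh (?k j * t / 2)) \<ge> 0" by (intro prod_nonneg) auto
    then show ?thesis unfolding \<theta>_def det_cosh abs_mult pair_prod_abs by simp
  qed
  ultimately show ?thesis by (simp only: W_def D_def u_def \<theta>_def pair_prod_abs)
qed

lemma sinh_mult_over_tendsto: "((\<lambda>t. sinh (c * t) / t) \<longlongrightarrow> (c::real)) (at_right 0)"
proof -
  have "((\<lambda>t. sinh (c * t)) has_real_derivative c) (at 0)"
    by (auto intro!: derivative_eq_intros)
  then have "((\<lambda>t. sinh (c * t) / t) \<longlongrightarrow> c) (at 0)"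
    by (simp add: has_field_derivative_iff)
  then show ?thesis by (rule filterlim_mono) (auto simp: at_within_le_at)
qed

lemma cosh_diff_over_tendsto:
  "((\<lambda>t. (2 * cosh (b * t) - 2 * cosh (a * t)) / t\<^sup>2) \<longlongrightarrow> (b\<^sup>2 - a\<^sup>2 :: real)) (at_right 0)"
proof -
  have *: "2 * cosh (c * t) = 2 + (2 * sinh (c / 2 * t))\<^sup>2" for c t :: real
    using cosh_double[of "c / 2 * t"] cosh_square_eq[of "c / 2 * t"] by (simp add: power_mult_distrib)
  have "((\<lambda>t. (2 * (sinh (b / 2 * t) / t))\<^sup>2 - (2 * (sinh (a / 2 * t) / t))\<^sup>2) \<longlongrightarrow> (2 * (b / 2))\<^sup>2 - (2 * (a / 2))\<^sup>2) (at_right 0)"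
    by (intro tendsto_intros sinh_mult_over_tendsto)
  moreover have "(2 * cosh (b * t) - 2 * cosh (a * t)) / t\<^sup>2 = (2 * (sinh (b / 2 * t) / t))\<^sup>2 - (2 * (sinh (a / 2 * t) / t))\<^sup>2" for t
    unfolding * by (simp add: power_mult_distrib power_divide diff_divide_distrib)
  ultimately show ?thesis by simp
qed

lemma vdm_cosh_tendsto:
  "((\<lambda>t. vdm (\<lambda>a. 2 * cosh (c a * t)) A / pair_prod (\<lambda>a b. t\<^sup>2) A) \<longlongrightarrow> vdm (\<lambda>a. (c a)\<^sup>2) A) (at_right 0)"
proof -
  have "((\<lambda>t. \<bar>(2 * cosh (c b * t) - 2 * cosh (c a * t)) / t\<^sup>2\<bar>) \<longlongrightarrow> \<bar>(c b)\<^sup>2 - (c a)\<^sup>2\<bar>) (at_right 0)" for a b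
    by (intro tendsto_rabs cosh_diff_over_tendsto)
  then have "((\<lambda>t. pair_prod (\<lambda>a b. \<bar>2 * cosh (c b * t) - 2 * cosh (c a * t)\<bar> / t\<^sup>2) A) \<longlongrightarrow> vdm (\<lambda>a. (c a)\<^sup>2) A) (at_right 0)"
    unfolding pair_prod_def case_prod_beta by (intro tendsto_prod) (simp add: abs_divide)
  then show ?thesis by (simp only: pair_prod_divide)
qed

lemma pair_prod_const_card:
  fixes A :: "nat set"
  assumes "finite A"
  shows "pair_prod (\<lambda>a b. x) A = pair_prod (\<lambda>i j. x) {..<card A}"
  using pair_prod_reindex[of "{..<card A}" "\<lambda>j. desc_list A ! j" "\<lambda>a b. x"] desc_list_bij[OF assms]
  by (simp add: bij_betw_def)

text \<open>
  All Vandermonde products in \<open>sum_vdm_cosh\<close> have the same number of factors, each of order t^2, and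
  there are m hyperbolic sines of order t on both sides.
\<close>
theorem sum_vdm_squares:
  assumes mn: "m \<le> n"
  shows "(\<Sum>A | A \<subseteq> {..<n} \<and> card A = m. vdm (\<lambda>a. (real a)\<^sup>2) A) *
      (vdm (\<lambda>i. (real i + 1 / 2)\<^sup>2) {..<m} * (\<Prod>i<m. real i + 1 / 2)) =
    (\<Prod>j<m. (real n + real m - 1) / 2 - real j) *
      vdm (\<lambda>j. ((real n + real m - 1) / 2 - real j)\<^sup>2) {..<m} *
      vdm (\<lambda>j. ((real n - real m) / 2 + real j)\<^sup>2) {..<m}"
proof -
  let ?I = "{..<m}" and ?P = "{A. A \<subseteq> {..<n} \<and> card A = m}"
  let ?l = "\<lambda>j. (real n + real m - 1) / 2 - real j" and ?k = "\<lambda>j. (real n - real m) / 2 + real j"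
  let ?T = "\<lambda>t. pair_prod (\<lambda>i j. t\<^sup>2 :: real) ?I"
  let ?W = "\<lambda>t A. (\<Prod>a\<in>A. 2 * cosh (real a * t / 2)) * (vdm (\<lambda>a. 2 * cosh (real a * t)) A / pair_prod (\<lambda>a b. t\<^sup>2) A)"
  let ?L = "\<lambda>t. (\<Sum>A\<in>?P. ?W t A) * (vdm (\<lambda>i. 2 * cosh ((real i + 1 / 2) * t)) ?I / ?T t) * (\<Prod>i<m. 2 * (sinh ((real i + 1 / 2) / 2 * t) / t))"
  let ?R = "\<lambda>t. (\<Prod>j<m. 2 * (sinh (?l j / 2 * t) / t)) * (vdm (\<lambda>j. 2 * cosh (?l j * t)) ?I / ?T t) *
      ((\<Prod>j<m. 2 * cosh (?k j * t / 2)) * (vdm (\<lambda>j. 2 * cosh (?k j * t)) ?I / ?T t))"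
  have ch: "((\<lambda>t. 2 * cosh (c * t / 2)) \<longlongrightarrow> 2) (at_right 0)" for c :: real
  proof -
    have "((\<lambda>t. 2 * cosh (c * t / 2)) \<longlongrightarrow> 2 * cosh (c * 0 / 2)) (at_right 0)"
      by (intro tendsto_intros) auto
    then show ?thesis by simp
  qed
  have sh: "((\<lambda>t. 2 * (sinh (c / 2 * t) / t)) \<longlongrightarrow> c) (at_right 0)" for c :: real
    using tendsto_mult[OF tendsto_const[of 2] sinh_mult_over_tendsto[of "c / 2"]] by simp
  \<comment> \<open>Both sides of \<open>sum_vdm_cosh\<close> are divided by t^m and by the square of the product of t^2 over all pairs.\<close>
  have limL: "(?L \<longlongrightarrow> (\<Sum>A\<in>?P. (\<Prod>a\<in>A. 2) * vdm (\<lambda>a. (real a)\<^sup>2) A) * vdm (\<lambda>i. (real i + 1 / 2)\<^sup>2) ?I * (\<Prod>i<m. real i + 1 / 2)) (at_right 0)"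
    by (intro tendsto_mult tendsto_sum tendsto_prod ch sh vdm_cosh_tendsto)
  have limR: "(?R \<longlongrightarrow> (\<Prod>j<m. ?l j) * vdm (\<lambda>j. (?l j)\<^sup>2) ?I * ((\<Prod>j<m. 2) * vdm (\<lambda>j. (?k j)\<^sup>2) ?I)) (at_right 0)"
    by (intro tendsto_mult tendsto_sum tendsto_prod ch sh vdm_cosh_tendsto)
  have ev: "eventually (\<lambda>t. ?L t = ?R t) (at_right 0)"
    using eventually_at_right_less[of "0::real"]
  proof eventually_elim
    case (elim t)
    have PA: "pair_prod (\<lambda>a b. t\<^sup>2) A = ?T t" if "A \<in> ?P" for A
      using that pair_prod_const_card[of A "t\<^sup>2"] finite_subset[of A "{..<n}"] by simp
    have WS: "(\<Sum>A\<in>?P. ?W t A) = (\<Sum>A\<in>?P. (\<Prod>a\<in>A. 2 * cosh (real a * t / 2)) * vdm (\<lambda>a. 2 * cosh (real a * t)) A) / ?T t"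
      unfolding sum_divide_distrib using PA by (intro sum.cong refl) simp
    have SH: "(\<Prod>j<m. 2 * (sinh (c j / 2 * t) / t)) = (\<Prod>j<m. 2 * sinh (c j * t / 2)) / t ^ m" for c :: "nat \<Rightarrow> real"
    proof -
      have "(\<Prod>j<m. 2 * (sinh (c j / 2 * t) / t)) = (\<Prod>j<m. 2 * sinh (c j * t / 2) / t)"
        by (intro prod.cong refl) (simp add: mult.commute)
      then show ?thesis by (simp add: prod_dividef)
    qed
    have alg: "(s / T) * (v / T) * (x / P) = (y / P) * (z / T) * (c * (w / T))" if "s * v * x = y * z * (c * w)"
      for s v x y z c w T P :: real
    proof -
      have "(s / T) * (v / T) * (x / P) = (s * v * x) / (T * T * P)" by simp
      also have "\<dots> = (y / P) * (z / T) * (c * (w / T))" unfolding that by simp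
      finally show ?thesis .
    qed
    show ?case
      unfolding WS SH[of "\<lambda>i. real i + 1 / 2"] SH[of ?l]
      by (rule alg) (rule sum_vdm_cosh[OF elim mn])
  qed
  have "(\<Sum>A\<in>?P. (\<Prod>a\<in>A. 2) * vdm (\<lambda>a. (real a)\<^sup>2) A) * vdm (\<lambda>i. (real i + 1 / 2)\<^sup>2) ?I * (\<Prod>i<m. real i + 1 / 2)
    = (\<Prod>j<m. ?l j) * vdm (\<lambda>j. (?l j)\<^sup>2) ?I * ((\<Prod>j<m. 2) * vdm (\<lambda>j. (?k j)\<^sup>2) ?I)"
    by (rule tendsto_unique[OF trivial_limit_at_right_real Lim_transform_eventually[OF limL ev] limR])
  moreover have "(\<Sum>A\<in>?P. (\<Prod>a\<in>A. 2) * vdm (\<lambda>a. (real a)\<^sup>2) A) = 2 ^ m * (\<Sum>A\<in>?P. vdm (\<lambda>a. (real a)\<^sup>2) A)"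
    unfolding sum_distrib_left by (intro sum.cong refl) auto
  ultimately show ?thesis by (simp add: mult_ac)
qed

section \<open>Reduction of the binomial sum to Vandermonde products\<close>

abbreviation squares :: "nat \<Rightarrow> real" where "squares a \<equiv> (real a)\<^sup>2"

text \<open>
  The inverse of a barycentric weight, up to sign, of the nodes 0, 1, 4, ..., n^2.
\<close>
definition node_prod :: "nat \<Rightarrow> nat \<Rightarrow> real" where
  "node_prod n a = (\<Prod>l\<in>{..n} - {a}. \<bar>squares l - squares a\<bar>)"

lemma fact_add_eq_prod: "fact (a + k) = fact a * (\<Prod>l<k. real a + 1 + real l)"
  by (induction k) (auto simp: algebra_simps)

lemma prod_diff_squares: "(\<Prod>l<a. squares a - squares l) * (if a = 0 then 1 else 2) = fact (2 * a)"
proof (cases "a = 0")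
  case False
  have "(\<Prod>l<a. squares a - squares l) = (\<Prod>l<a. real a - real l) * (\<Prod>l<a. real a + real l)"
    unfolding prod.distrib[symmetric] by (intro prod.cong refl) (simp add: power2_eq_square algebra_simps)
  moreover have "(\<Prod>l<a. real a - real l) = fact a"
    by (simp add: fact_prod_rev of_nat_diff atLeast0LessThan)
  moreover have "(\<Prod>l<a. real a + real l) * (real a + real a) = real a * (\<Prod>l<a. real a + 1 + real l)"
    using prod.lessThan_Suc_shift[of "\<lambda>l. real a + real l" a] by (simp add: add_ac)
  then have "(\<Prod>l<a. real a + real l) * 2 = (\<Prod>l<a. real a + 1 + real l)"
    using False by (simp add: field_simps)
  moreover have "fact (2 * a) = fact a * (\<Prod>l<a. real a + 1 + real l)"
    using fact_add_eq_prod[of a a] by (simp add: mult_2)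
  ultimately show ?thesis using False by (simp add: mult.assoc)
qed simp

lemma node_prod_eq:
  assumes "a \<le> n"
  shows "node_prod n a * (if a = 0 then 1 else 2) = fact (n - a) * fact (n + a)"
  using assms
proof (induction n rule: dec_induct)
  case base
  have "{..a} - {a} = {..<a}" by auto
  moreover have "(\<Prod>l<a. \<bar>squares l - squares a\<bar>) = (\<Prod>l<a. squares a - squares l)"
    by (intro prod.cong refl) (subst abs_minus_commute, simp add: power_mono less_imp_le)
  ultimately show ?case
    using prod_diff_squares[of a] by (simp add: node_prod_def mult_2)
next
  case (step n)
  have "{..Suc n} - {a} = insert (Suc n) ({..n} - {a})" using step by auto
  then have "node_prod (Suc n) a = \<bar>squares (Suc n) - squares a\<bar> * node_prod n a"
    by (simp add: node_prod_def)
  also have "\<bar>squares (Suc n) - squares a\<bar> = (real (Suc n) - real a) * (real (Suc n) + real a)"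
  proof -
    have "squares a \<le> squares (Suc n)" using step(1) by (intro power_mono) auto
    then have "\<bar>squares (Suc n) - squares a\<bar> = squares (Suc n) - squares a" by simp
    then show ?thesis by (simp add: power2_eq_square algebra_simps)
  qed
  finally have "node_prod (Suc n) a * (if a = 0 then 1 else 2) = (real (Suc n) - real a) * (real (Suc n) + real a) * (fact (n - a) * fact (n + a))"
    using step.IH by (simp only: mult.assoc)
  also have "\<dots> = fact (Suc n - a) * fact (Suc n + a)"
    using step(1) by (simp add: Suc_diff_le of_nat_diff algebra_simps)
  finally show ?case .
qed


text \<open>
  The factor 2 for a > 0 in \<open>node_prod_eq\<close> stands for the two nodes a and -a.
\<close>
lemma fibre_sum:
  assumes "a \<le> n"
  shows "(\<Sum>k\<in>{k\<in>{- int n..int n}. nat \<bar>k\<bar> = a}. real ((2 * n) choose nat (int n + k))) = fact (2 * n) / node_prod n a"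
proof -
  have b: "real ((2 * n) choose (n + a)) = fact (2 * n) / (fact (n - a) * fact (n + a))"
    using assms by (subst binomial_fact) (auto simp: mult.commute)
  have "(\<Sum>k\<in>{k\<in>{- int n..int n}. nat \<bar>k\<bar> = a}. real ((2 * n) choose nat (int n + k))) =
     real ((2 * n) choose (n + a)) * (if a = 0 then 1 else 2)"
  proof (cases "a = 0")
    case True
    then have "{k\<in>{- int n..int n}. nat \<bar>k\<bar> = a} = {0}" by auto
    then show ?thesis using True by simp
  next
    case False
    then have "{k\<in>{- int n..int n}. nat \<bar>k\<bar> = a} = {int a, - int a}" using assms by auto
    moreover have "(2 * n) choose nat (int n - int a) = (2 * n) choose (n + a)"
      using assms binomial_symmetric[of "n + a" "2 * n"] by (simp add: nat_diff_distrib)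
    moreover have "nat (int n + int a) = n + a" by simp
    ultimately show ?thesis using False by simp
  qed
  moreover have "fact (2 * n) / node_prod n a = fact (2 * n) / (node_prod n a * (if a = 0 then 1 else 2)) * (if a = 0 then 1 else 2)"
    by simp
  ultimately show ?thesis unfolding node_prod_eq[OF assms] b by simp
qed

lemma sum_PiE_fibres:
  fixes F :: "('i \<Rightarrow> 'b) \<Rightarrow> 'c::comm_semiring_1"
  assumes finI: "finite I" and finX: "finite X" and gX: "g ` X \<subseteq> Y" and finY: "finite Y"
    and F: "\<And>a b. (\<And>i. i \<in> I \<Longrightarrow> a i = b i) \<Longrightarrow> F a = F b"
  shows "(\<Sum>k\<in>I \<rightarrow>\<^sub>E X. F (\<lambda>i. g (k i)) * (\<Prod>i\<in>I. c (k i))) =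
    (\<Sum>a\<in>I \<rightarrow>\<^sub>E Y. F a * (\<Prod>i\<in>I. \<Sum>k\<in>{k\<in>X. g k = a i}. c k))"
proof -
  let ?h = "\<lambda>k. restrict (\<lambda>i. g (k i)) I"
  let ?t = "\<lambda>k. F (\<lambda>i. g (k i)) * (\<Prod>i\<in>I. c (k i))"
  have "(\<Sum>k\<in>I \<rightarrow>\<^sub>E X. ?t k) = (\<Sum>a\<in>I \<rightarrow>\<^sub>E Y. \<Sum>k\<in>{k\<in>I \<rightarrow>\<^sub>E X. ?h k = a}. ?t k)"
    using gX by (intro sum.group[symmetric] finite_PiE finI finX finY) (auto simp: image_subset_iff dest: PiE_mem)
  also have "\<dots> = (\<Sum>a\<in>I \<rightarrow>\<^sub>E Y. F a * (\<Prod>i\<in>I. \<Sum>k\<in>{k\<in>X. g k = a i}. c k))"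
  proof (rule sum.cong[OF refl])
    fix a assume a: "a \<in> I \<rightarrow>\<^sub>E Y"
    have "{k\<in>I \<rightarrow>\<^sub>E X. ?h k = a} = PiE I (\<lambda>i. {k\<in>X. g k = a i})"
    proof (intro equalityI subsetI)
      fix k assume k: "k \<in> PiE I (\<lambda>i. {k\<in>X. g k = a i})"
      have "?h k = a"
      proof
        fix i
        show "?h k i = a i" using k a by (cases "i \<in> I") (auto simp: PiE_def extensional_def Pi_def)
      qed
      then show "k \<in> {k\<in>I \<rightarrow>\<^sub>E X. ?h k = a}" using k by auto
    qed auto
    moreover have "?t k = F a * (\<Prod>i\<in>I. c (k i))" if "k \<in> PiE I (\<lambda>i. {k\<in>X. g k = a i})" for k
    proof -
      have "F (\<lambda>i. g (k i)) = F a" using that by (intro F) (auto dest: PiE_mem)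
      then show ?thesis by simp
    qed
    ultimately show "(\<Sum>k\<in>{k\<in>I \<rightarrow>\<^sub>E X. ?h k = a}. ?t k) = F a * (\<Prod>i\<in>I. \<Sum>k\<in>{k\<in>X. g k = a i}. c k)"
      using finI finX by (simp add: prod_sum_PiE sum_distrib_left)
  qed
  finally show ?thesis .
qed

lemma card_enumerations:
  assumes "finite K" "card K = r"
  shows "card {a \<in> {1..r} \<rightarrow>\<^sub>E K. inj_on a {1..r} \<and> a ` {1..r} = K} = fact r"
proof -
  let ?E = "{a \<in> {1..r} \<rightarrow>\<^sub>E K. inj_on a {1..r} \<and> a ` {1..r} = K}"
  let ?f = "\<lambda>a. map a [1..<Suc r]" and ?g = "\<lambda>xs. restrict (\<lambda>i. xs ! (i - 1)) {1..r}"
  have "bij_betw ?f ?E (permutations_of_set K)"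
  proof (rule bij_betw_byWitness[where f' = ?g])
    show "\<forall>a\<in>?E. ?g (?f a) = a"
      by (auto simp: fun_eq_iff PiE_def extensional_def simp del: upt_Suc)
    show "\<forall>xs\<in>permutations_of_set K. ?f (?g xs) = xs"
      using assms by (auto simp: length_finite_permutations_of_set intro!: nth_equalityI simp del: upt_Suc)
    show "?f ` ?E \<subseteq> permutations_of_set K"
      by (auto simp: permutations_of_set_def distinct_map atLeastLessThanSuc_atLeastAtMost simp del: upt_Suc)
    show "?g ` permutations_of_set K \<subseteq> ?E"
    proof (clarify)
      fix xs assume xs: "xs \<in> permutations_of_set K"
      then have d: "distinct xs" "set xs = K" and len: "length xs = r"
        using assms by (auto simp: length_finite_permutations_of_set dest: permutations_of_setD)
      have im: "?g xs ` {1..r} = K"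
      proof -
        have "?g xs ` {1..r} = (\<lambda>i. xs ! (i - 1)) ` Suc ` {..<r}"
          unfolding image_Suc_lessThan by (intro image_cong) auto
        also have "\<dots> = (\<lambda>i. xs ! i) ` {..<r}" by (simp add: image_image)
        also have "\<dots> = K" unfolding d(2)[symmetric] set_conv_nth len by auto
        finally show ?thesis .
      qed
      moreover have "inj_on (?g xs) {1..r}"
        using im assms by (intro eq_card_imp_inj_on) auto
      ultimately show "?g xs \<in> {1..r} \<rightarrow>\<^sub>E K \<and> inj_on (?g xs) {1..r} \<and> ?g xs ` {1..r} = K"
        by auto
    qed
  qed
  then have "card ?E = card (permutations_of_set K)" by (rule bij_betw_same_card)
  then show ?thesis using assms by simp
qed

text \<open>
  Every set of r elements is enumerated by r! functions.
\<close>
lemma sum_over_enumerations: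
  assumes finX: "finite X"
    and zero: "\<And>a. a \<in> {1..r} \<rightarrow>\<^sub>E X \<Longrightarrow> \<not> inj_on a {1..r} \<Longrightarrow> F a = 0"
    and F: "\<And>a. a \<in> {1..r} \<rightarrow>\<^sub>E X \<Longrightarrow> inj_on a {1..r} \<Longrightarrow> F a = G (a ` {1..r})"
  shows "(\<Sum>a\<in>{1..r} \<rightarrow>\<^sub>E X. F a) = fact r * (\<Sum>K | K \<subseteq> X \<and> card K = r. G K :: real)"
proof -
  let ?J = "{a \<in> {1..r} \<rightarrow>\<^sub>E X. inj_on a {1..r}}" and ?T = "{K. K \<subseteq> X \<and> card K = r}"
  have fin: "finite ({1..r} \<rightarrow>\<^sub>E X)" using finX by (intro finite_PiE) auto
  have "(\<Sum>a\<in>{1..r} \<rightarrow>\<^sub>E X. F a) = (\<Sum>a\<in>?J. F a)"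
    using fin zero by (intro sum.mono_neutral_right) auto
  also have "\<dots> = (\<Sum>K\<in>?T. \<Sum>a\<in>{a\<in>?J. a ` {1..r} = K}. F a)"
    using fin finX by (intro sum.group[symmetric]) (auto simp: card_image)
  also have "\<dots> = (\<Sum>K\<in>?T. fact r * G K)"
  proof (rule sum.cong[OF refl])
    fix K assume K: "K \<in> ?T"
    then have "finite K" "card K = r" using finX finite_subset by auto
    moreover have "{a\<in>?J. a ` {1..r} = K} = {a \<in> {1..r} \<rightarrow>\<^sub>E K. inj_on a {1..r} \<and> a ` {1..r} = K}"
      using K by (auto simp: PiE_def Pi_def)
    ultimately have "card {a\<in>?J. a ` {1..r} = K} = fact r" using card_enumerations[of K r] by simp
    moreover have "(\<Sum>a\<in>{a\<in>?J. a ` {1..r} = K}. F a) = (\<Sum>a\<in>{a\<in>?J. a ` {1..r} = K}. G K)"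
      using F by (intro sum.cong) auto
    ultimately show "(\<Sum>a\<in>{a\<in>?J. a ` {1..r} = K}. F a) = fact r * G K" by simp
  qed
  finally show ?thesis by (simp add: sum_distrib_left)
qed

lemma pair_prod_union:
  assumes "finite A" "finite B" "A \<inter> B = {}" "\<And>i j. f i j = f j i"
  shows "pair_prod f (A \<union> B) = pair_prod f A * pair_prod f B * (\<Prod>a\<in>A. \<Prod>b\<in>B. f a b)"
  using assms
proof (induction A)
  case (insert x A)
  then have "pair_prod f (insert x A \<union> B) = pair_prod f (A \<union> B) * ((\<Prod>j\<in>A. f x j) * (\<Prod>j\<in>B. f x j))"
    by (simp add: pair_prod_insert prod.union_disjoint)
  then show ?case using insert by (simp add: pair_prod_insert mult_ac)
qed simp

lemma prod_remove_eq_pair_prod_square: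
  assumes "finite A" "\<And>i j. f i j = f j i"
  shows "(\<Prod>a\<in>A. \<Prod>b\<in>A - {a}. f a b) = (pair_prod f A)\<^sup>2"
  using assms
proof (induction A)
  case (insert x A)
  have "(\<Prod>b\<in>insert x A - {a}. f a b) = f x a * (\<Prod>b\<in>A - {a}. f a b)" if "a \<in> A" for a
  proof -
    have "insert x A - {a} = insert x (A - {a})" using that insert by auto
    then show ?thesis using insert by simp
  qed
  moreover have "insert x A - {x} = A" using insert by auto
  ultimately have "(\<Prod>a\<in>insert x A. \<Prod>b\<in>insert x A - {a}. f a b) = (\<Prod>b\<in>A. f x b) * ((\<Prod>a\<in>A. f x a) * (pair_prod f A)\<^sup>2)"
    using insert by (simp add: prod.distrib)
  then show ?case using insert by (simp add: pair_prod_insert power2_eq_square mult_ac)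
qed simp

lemma vdm_squares_pos: "vdm squares A > 0"
proof (rule pair_prod_pos)
  fix i j :: nat assume "i < j"
  then have "squares i < squares j" by (intro power_strict_mono) auto
  then show "\<bar>squares j - squares i\<bar> > 0" by linarith
qed

text \<open>
  The product of the node products over K counts every pair inside K twice and every pair between K
  and its complement once. Multiplied by the Vandermonde products of K and of the complement, the
  latter pairs give the Vandermonde product of all nodes.
\<close>
lemma vdm_complement:
  assumes K: "K \<subseteq> {..n}"
  shows "vdm squares K / (\<Prod>k\<in>K. node_prod n k) = vdm squares ({..n} - K) / vdm squares {..n}"
proof -
  let ?f = "\<lambda>a b. \<bar>squares b - squares a\<bar>" and ?L = "{..n} - K"
  have fin: "finite K" using K finite_subset by blast
  have sym: "?f i j = ?f j i" for i j by (rule abs_minus_commute)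
  let ?X = "\<Prod>a\<in>K. \<Prod>b\<in>?L. ?f a b"
  have "K \<union> ?L = {..n}" using K by auto
  then have all: "vdm squares {..n} = vdm squares K * vdm squares ?L * ?X"
    using pair_prod_union[of K ?L ?f] fin sym by simp
  have "node_prod n k = (\<Prod>b\<in>K - {k}. ?f k b) * (\<Prod>b\<in>?L. ?f k b)" if "k \<in> K" for k
  proof -
    have "{..n} - {k} = (K - {k}) \<union> ?L" using that K by auto
    then show ?thesis unfolding node_prod_def using fin by (subst prod.union_disjoint[symmetric]) auto
  qed
  then have p: "(\<Prod>k\<in>K. node_prod n k) = (vdm squares K)\<^sup>2 * ?X"
    using prod_remove_eq_pair_prod_square[of K ?f] fin sym by (simp add: prod.distrib)
  have "?X \<noteq> 0" using vdm_squares_pos[of "{..n}"] unfolding all by (metis less_irrefl mult_zero_right)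
  then show ?thesis
    unfolding p all using vdm_squares_pos[of K] vdm_squares_pos[of ?L] by (simp add: power2_eq_square field_simps)
qed

text \<open>
  The summand only depends on the |k_i| apart from the binomial coefficients, whose sums over the fibres
  of the absolute value are the weights in \<open>fibre_sum\<close>. The functions i \<mapsto> |k_i| that are not injective do
  not contribute.
\<close>
theorem binomial_sum_eq_sum_complements:
  "real_of_int (binomial_sum r n) =
     fact r * fact (2 * n) ^ r * (\<Sum>K | K \<subseteq> {..n} \<and> card K = r. vdm squares ({..n} - K)) / vdm squares {..n}"
proof -
  let ?I = "{1..r}" and ?f = "\<lambda>(a :: nat \<Rightarrow> nat) i j. \<bar>squares (a j) - squares (a i)\<bar>"
  let ?F = "\<lambda>a. pair_prod (?f a) ?I" and ?c = "\<lambda>k. real ((2 * n) choose nat (int n + k))"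
  have gaps: "(\<Prod>(i, j)\<in>{(i, j). 1 \<le> i \<and> i < j \<and> j \<le> r}. real_of_int \<bar>(k i)\<^sup>2 - (k j)\<^sup>2\<bar>) = ?F (\<lambda>i. nat \<bar>k i\<bar>)" for k :: "nat \<Rightarrow> int"
    unfolding pair_prod_def
  proof (intro prod.cong)
    show "{(i, j). 1 \<le> i \<and> i < j \<and> j \<le> r} = {(i, j). i \<in> ?I \<and> j \<in> ?I \<and> i < j}" by auto
  qed (auto simp: abs_minus_commute)
  have "real_of_int (binomial_sum r n) = (\<Sum>k\<in>?I \<rightarrow>\<^sub>E {- int n..int n}. ?F (\<lambda>i. nat \<bar>k i\<bar>) * (\<Prod>i\<in>?I. ?c (k i)))"
    unfolding binomial_sum_def of_int_sum of_int_mult of_int_prod gaps[symmetric]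
    by (intro sum.cong refl arg_cong2[of _ _ _ _ "(*)"]) (auto simp: case_prod_beta)
  also have "\<dots> = (\<Sum>a\<in>?I \<rightarrow>\<^sub>E {..n}. ?F a * (\<Prod>i\<in>?I. \<Sum>k\<in>{k\<in>{- int n..int n}. nat \<bar>k\<bar> = a i}. ?c k))"
    by (rule sum_PiE_fibres) (auto intro!: pair_prod_cong)
  also have "\<dots> = (\<Sum>a\<in>?I \<rightarrow>\<^sub>E {..n}. ?F a * (\<Prod>i\<in>?I. fact (2 * n) / node_prod n (a i)))"
  proof (intro sum.cong arg_cong2[of _ _ _ _ "(*)"] prod.cong refl)
    fix a i assume "a \<in> ?I \<rightarrow>\<^sub>E {..n}" "i \<in> ?I"
    then have "a i \<le> n" by auto
    then show "(\<Sum>k\<in>{k\<in>{- int n..int n}. nat \<bar>k\<bar> = a i}. ?c k) = fact (2 * n) / node_prod n (a i)"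
      by (rule fibre_sum)
  qed
  also have "\<dots> = fact r * (\<Sum>K | K \<subseteq> {..n} \<and> card K = r. fact (2 * n) ^ r * (vdm squares K / (\<Prod>k\<in>K. node_prod n k)))"
  proof (rule sum_over_enumerations)
    fix a assume a: "a \<in> ?I \<rightarrow>\<^sub>E {..n}" and ninj: "\<not> inj_on a ?I"
    then obtain i j where ij: "i \<in> ?I" "j \<in> ?I" "a i = a j" "i < j"
      unfolding inj_on_def by (metis linorder_neqE_nat)
    then have "?F a = 0"
      unfolding pair_prod_def by (intro prod_zero bexI[of _ "(i, j)"] finite_pairs) (use ij in auto)
    then show "?F a * (\<Prod>i\<in>?I. fact (2 * n) / node_prod n (a i)) = 0" by simp
  next
    fix a assume a: "a \<in> ?I \<rightarrow>\<^sub>E {..n}" and inj: "inj_on a ?I"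
    have "?F a = vdm squares (a ` ?I)"
      using inj by (intro pair_prod_reindex[symmetric]) (auto simp: abs_minus_commute)
    moreover have "(\<Prod>i\<in>?I. fact (2 * n) / node_prod n (a i)) = fact (2 * n) ^ r / (\<Prod>k\<in>a ` ?I. node_prod n k)"
      using inj by (simp add: prod_dividef prod.reindex)
    ultimately show "?F a * (\<Prod>i\<in>?I. fact (2 * n) / node_prod n (a i)) =
      fact (2 * n) ^ r * (vdm squares (a ` ?I) / (\<Prod>k\<in>a ` ?I. node_prod n k))" by simp
  qed simp
  also have "\<dots> = fact r * (\<Sum>K | K \<subseteq> {..n} \<and> card K = r. fact (2 * n) ^ r * (vdm squares ({..n} - K) / vdm squares {..n}))"
    by (intro arg_cong2[of _ _ _ _ "(*)"] sum.cong refl) (auto simp: vdm_complement)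
  finally show ?thesis by (simp add: sum_distrib_left sum_divide_distrib mult.assoc)
qed

corollary binomial_sum_eq_0: "r > n + 1 \<Longrightarrow> binomial_sum r n = 0"
proof -
  assume r: "r > n + 1"
  have "\<not> (K \<subseteq> {..n} \<and> card K = r)" for K using card_mono[of "{..n}" K] r by auto
  then have none: "{K. K \<subseteq> {..n} \<and> card K = r} = {}" by blast
  have "real_of_int (binomial_sum r n) = 0" unfolding binomial_sum_eq_sum_complements none by simp
  then show ?thesis by simp
qed

corollary binomial_sum_eq_sum_subsets:
  assumes "r + m = Suc n"
  shows "real_of_int (binomial_sum r n) =
     fact r * fact (2 * n) ^ r * (\<Sum>A | A \<subseteq> {..<Suc n} \<and> card A = m. vdm squares A) / vdm squares {..n}"
proof -
  have "(\<Sum>K | K \<subseteq> {..n} \<and> card K = r. vdm squares ({..n} - K)) = (\<Sum>A | A \<subseteq> {..<Suc n} \<and> card A = m. vdm squares A)"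
  proof (rule sum.reindex_bij_witness[of _ "\<lambda>A. {..n} - A" "\<lambda>K. {..n} - K"])
    fix K assume "K \<in> {K. K \<subseteq> {..n} \<and> card K = r}"
    then show "{..n} - ({..n} - K) = K" "{..n} - K \<in> {A. A \<subseteq> {..<Suc n} \<and> card A = m}"
      using assms finite_subset[of K "{..n}"] by (auto simp: card_Diff_subset)
  next
    fix K assume "K \<in> {A. A \<subseteq> {..<Suc n} \<and> card A = m}"
    then show "{..n} - ({..n} - K) = K" "{..n} - K \<in> {K. K \<subseteq> {..n} \<and> card K = r}"
      using assms finite_subset[of K "{..n}"] by (auto simp: card_Diff_subset lessThan_Suc_atMost)
  qed simp
  then show ?thesis using binomial_sum_eq_sum_complements[of r n] by simp
qed

section \<open>The product formula in terms of the Gamma function\<close>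

lemma vdm_lessThan_Suc: "vdm f {..<Suc m} = vdm f {..<m} * (\<Prod>j<m. \<bar>f m - f j\<bar>)"
  unfolding lessThan_Suc by (subst pair_prod_insert) (auto simp: abs_minus_commute)

lemma vdm_squares_atMost_Suc: "vdm squares {..Suc n} = vdm squares {..n} * fact (2 * Suc n) / 2"
proof -
  have "{..Suc n} - {Suc n} = {..n}" by auto
  then have "vdm squares {..Suc n} = vdm squares {..n} * node_prod (Suc n) (Suc n)"
    unfolding node_prod_def
    by (subst pair_prod_remove[of "{..Suc n}" "Suc n"]) (auto simp: abs_minus_commute)
  moreover have "node_prod (Suc n) (Suc n) * 2 = fact (2 * Suc n)"
  proof -
    have "Suc n + Suc n = 2 * Suc n" by simp
    then show ?thesis using node_prod_eq[OF order_refl, of "Suc n"] by (simp del: fact_Suc add_Suc add_Suc_right mult_Suc_right)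
  qed
  ultimately show ?thesis by simp
qed

lemma prod_interval_shift:
  fixes g :: "nat \<Rightarrow> 'a::comm_monoid_mult"
  shows "(\<Prod>k\<in>{Suc m..<Suc (m + q)}. g k) * g m = (\<Prod>k\<in>{m..<m + q}. g k) * g (m + q)"
proof -
  have "(\<Prod>k\<in>{m..<Suc (m + q)}. g k) = (\<Prod>k\<in>{m..<m + q}. g k) * g (m + q)" by simp
  moreover have "(\<Prod>k\<in>{m..<Suc (m + q)}. g k) = g m * (\<Prod>k\<in>{Suc m..<Suc (m + q)}. g k)"
    by (rule prod.atLeast_Suc_lessThan) simp
  ultimately show ?thesis by (simp add: mult.commute)
qed

text \<open>
  The value of the sum in \<open>sum_vdm_squares\<close> for n = q + m + 1, where q stands for r - 1. The
  numerator contains the products of the Weyl dimension formula for two representations of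
  rectangular highest weight, one of type B and one of type D.
\<close>
definition dim_ratio :: "nat \<Rightarrow> nat \<Rightarrow> real" where
  "dim_ratio q m =
     (\<Prod>j<m. (real q + 2) / 2 + real j) *
      vdm (\<lambda>j. ((real q + 2) / 2 + real j)\<^sup>2) {..<m} *
      vdm (\<lambda>j. ((real q + 1) / 2 + real j)\<^sup>2) {..<m} /
     (vdm (\<lambda>i. (real i + 1 / 2)\<^sup>2) {..<m} * (\<Prod>i<m. real i + 1 / 2))"

text \<open>
  The nodes of the first Vandermonde product in \<open>sum_vdm_squares\<close> are listed there in decreasing order.
\<close>
lemma sum_vdm_eq_dim_ratio:
  "(\<Sum>A | A \<subseteq> {..<Suc (q + m)} \<and> card A = m. vdm squares A) = dim_ratio q m"
proof -
  let ?l = "\<lambda>j. (real (Suc (q + m)) + real m - 1) / 2 - real j" and ?L = "\<lambda>j. (real q + 2) / 2 + real j"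
  let ?h = "\<lambda>j. m - Suc j"
  have lL: "?l (?h j) = ?L j" if "j < m" for j
    using that by (simp add: of_nat_diff field_simps)
  have bij: "bij_betw ?h {..<m} {..<m}"
    by (rule bij_betw_byWitness[where f' = ?h]) auto
  have "(\<Prod>j<m. ?L j) = (\<Prod>j<m. ?l (?h j))"
    by (intro prod.cong refl) (simp only: lL lessThan_iff)
  also have "\<dots> = (\<Prod>j<m. ?l j)" by (rule prod.reindex_bij_betw[OF bij])
  finally have a: "(\<Prod>j<m. ?l j) = (\<Prod>j<m. ?L j)" ..
  have b: "vdm (\<lambda>j. (?l j)\<^sup>2) {..<m} = vdm (\<lambda>j. (?L j)\<^sup>2) {..<m}"
  proof -
    have "vdm (\<lambda>j. (?l j)\<^sup>2) (?h ` {..<m}) = pair_prod (\<lambda>a b. \<bar>(?l (?h b))\<^sup>2 - (?l (?h a))\<^sup>2\<bar>) {..<m}"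
      using bij by (intro pair_prod_reindex) (auto simp: bij_betw_def abs_minus_commute)
    also have "\<dots> = vdm (\<lambda>j. (?L j)\<^sup>2) {..<m}"
      by (rule pair_prod_cong) (simp only: lL lessThan_iff)
    finally show ?thesis using bij by (simp add: bij_betw_def)
  qed
  have c: "(real (Suc (q + m)) - real m) / 2 = (real q + 1) / 2" by simp
  have "vdm (\<lambda>i. (real i + 1 / 2)\<^sup>2) {..<m} > 0"
  proof (rule pair_prod_pos)
    fix i j :: nat assume "i < j"
    then have "(real i + 1 / 2)\<^sup>2 < (real j + 1 / 2)\<^sup>2" by (intro power_strict_mono) auto
    then show "\<bar>(real j + 1 / 2)\<^sup>2 - (real i + 1 / 2)\<^sup>2\<bar> > 0" by linarith
  qed
  moreover have "(\<Prod>i<m. real i + 1 / 2) > 0" by (intro prod_pos) auto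
  ultimately have D: "vdm (\<lambda>i. (real i + 1 / 2)\<^sup>2) {..<m} * (\<Prod>i<m. real i + 1 / 2) \<noteq> 0"
    by (metis less_irrefl mult_eq_0_iff)
  have "m \<le> Suc (q + m)" by simp
  from sum_vdm_squares[OF this, unfolded a b c] show ?thesis
    unfolding dim_ratio_def by (rule nonzero_eq_divide_eq[OF D, THEN iffD2])
qed

lemma dim_ratio_Suc:
  "dim_ratio q (Suc m) = dim_ratio q m *
     ((real q + 2 + 2 * real m) / (2 * real m + 1) * (fact m)\<^sup>2 * fact (q + 2 * m + 1) * fact (q + 2 * m) /
       (fact (q + m + 1) * fact (q + m) * fact (2 * m)))"
proof -
  have gen: "(\<Prod>j<m. \<bar>(c + real m)\<^sup>2 - (c + real j)\<^sup>2\<bar>) = fact m * (\<Prod>j<m. 2 * c + real m + real j)" if "c \<ge> 0" for c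
  proof -
    have "(\<Prod>j<m. \<bar>(c + real m)\<^sup>2 - (c + real j)\<^sup>2\<bar>) = (\<Prod>j<m. (real m - real j) * (2 * c + real m + real j))"
    proof (rule prod.cong[OF refl])
      fix j assume "j \<in> {..<m}"
      then have "(c + real m)\<^sup>2 - (c + real j)\<^sup>2 = (real m - real j) * (2 * c + real m + real j)" "real m - real j \<ge> 0"
        by (auto simp: power2_eq_square algebra_simps)
      then show "\<bar>(c + real m)\<^sup>2 - (c + real j)\<^sup>2\<bar> = (real m - real j) * (2 * c + real m + real j)"
        using that by simp
    qed
    also have "\<dots> = (\<Prod>j<m. real m - real j) * (\<Prod>j<m. 2 * c + real m + real j)" by (rule prod.distrib)
    also have "(\<Prod>j<m. real m - real j) = fact m"
      by (simp add: fact_prod_rev of_nat_diff atLeast0LessThan)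
    finally show ?thesis .
  qed
  have quot: "(\<Prod>j<m. \<bar>(c + real m)\<^sup>2 - (c + real j)\<^sup>2\<bar>) = fact m * (fact (a + m) / fact a)"
    if "c \<ge> 0" "2 * c + real m = real a + 1" for c a
    unfolding gen[OF that(1)] that(2) using fact_add_eq_prod[of a m] by simp
  have L: "(\<Prod>j<m. \<bar>((real q + 2) / 2 + real m)\<^sup>2 - ((real q + 2) / 2 + real j)\<^sup>2\<bar>) = fact m * (fact (q + 2 * m + 1) / fact (q + m + 1))"
  proof -
    have i: "q + 2 * m + 1 = q + m + 1 + m" by simp
    show ?thesis unfolding i by (rule quot) simp_all
  qed
  have K: "(\<Prod>j<m. \<bar>((real q + 1) / 2 + real m)\<^sup>2 - ((real q + 1) / 2 + real j)\<^sup>2\<bar>) = fact m * (fact (q + 2 * m) / fact (q + m))"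
  proof -
    have i: "q + 2 * m = q + m + m" by simp
    show ?thesis unfolding i by (rule quot) simp_all
  qed
  have H: "(\<Prod>j<m. \<bar>(real m + 1 / 2)\<^sup>2 - (real j + 1 / 2)\<^sup>2\<bar>) = fact m * (fact (2 * m) / fact m)"
    unfolding mult_2 add.commute[of _ "1 / 2 :: real"] by (rule quot) simp_all
  have lin: "((real q + 2) / 2 + real m) / (real m + 1 / 2) = (real q + 2 + 2 * real m) / (2 * real m + 1)"
  proof -
    have e: "(real q + 2) / 2 + real m = (real q + 2 + 2 * real m) / 2" "real m + 1 / 2 = (2 * real m + 1) / 2" by simp_all
    have "x / 2 / (y / 2) = x / y" for x y :: real by simp
    then show ?thesis unfolding e .
  qed
  have alg: "P * a * (V * (F * (b / c))) * (W * (F * (d / e))) / (U * (F * (g / F)) * (Q * h)) =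
      P * V * W / (U * Q) * (a / h * F\<^sup>2 * b * d / (c * e * g))"
    if "F > 0" "c > 0" "e > 0" "g > 0" for P a V F b c W d e U g Q h :: real
  proof -
    have "F * (g / F) = g" using that by simp
    then show ?thesis
      by (simp only: times_divide_eq_left times_divide_eq_right divide_divide_eq_left power2_eq_square mult_ac)
  qed
  show ?thesis
    unfolding dim_ratio_def vdm_lessThan_Suc L K H prod.lessThan_Suc lin[symmetric]
    by (rule alg) auto
qed

lemma double_fact_products:
  "(\<Prod>i=1..q. fact (2 * i))\<^sup>2 = fact (2 * q) * 2 ^ q * fact q * (\<Prod>k<2 * q. fact k :: real)"
proof (induction q)
  case (Suc q)
  have "(\<Prod>i=1..Suc q. fact (2 * i))\<^sup>2 = (\<Prod>i=1..q. fact (2 * i))\<^sup>2 * (fact (2 * Suc q) :: real)\<^sup>2"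
    by (simp add: power_mult_distrib)
  also have "\<dots> = fact (2 * q) * 2 ^ q * fact q * (\<Prod>k<2 * q. fact k) * (fact (2 * Suc q) * ((2 * real q + 2) * fact (Suc (2 * q))))"
    unfolding Suc.IH by (simp add: power2_eq_square)
  also have "\<dots> = fact (2 * Suc q) * 2 ^ Suc q * fact (Suc q) * (\<Prod>k<2 * Suc q. fact k)"
    by (simp add: mult_ac distrib_left distrib_right)
  finally show ?case .
qed simp

lemma vdm_squares_atMost: "vdm squares {..n} = (\<Prod>i=1..n. fact (2 * i)) / 2 ^ n"
proof (induction n)
  case 0
  have e: "vdm squares {..0} = 1" unfolding pair_prod_def by (rule prod.neutral) auto
  show ?case unfolding e by simp
next
  case (Suc n)
  then show ?case unfolding vdm_squares_atMost_Suc by simp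
qed

definition central_ratio :: "nat \<Rightarrow> real" where
  "central_ratio k = fact (2 * k + 1) / (fact k)\<^sup>2"

text \<open>
  Induction on m: both sides are multiplied by the same quotient of factorials when m grows by one,
  since the products over intervals on the right change only at their ends. For m = 0 the claim
  reduces to \<open>double_fact_products\<close>.
\<close>
lemma dim_ratio_closed_form:
  "fact (2 * (q + m)) * dim_ratio q m / vdm squares {..q + m} =
     2 ^ (m + q) * (\<Prod>j<m. real q + 2 + 2 * real j) / fact (q + m) * (\<Prod>i=1..q. fact i) *
      (\<Prod>k\<in>{m..<m + q}. central_ratio k) / (\<Prod>k\<in>{q + 2 * m..<2 * q + 2 * m}. fact k)"
proof (induction m)
  case 0
  have c: "(\<Prod>k<q. central_ratio k) * 2 ^ q * ((\<Prod>i=1..q. fact i) * (\<Prod>k<q. fact k)) = (\<Prod>i=1..q. fact (2 * i))"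
  proof (induction q)
    case (Suc q)
    have "central_ratio q * 2 * (fact (Suc q) * fact q) = fact (2 * Suc q)"
      by (simp add: central_ratio_def power2_eq_square field_simps)
    then show ?case using Suc.IH by (simp add: mult_ac)
  qed simp
  have s: "(\<Prod>k<2 * q. fact k) = (\<Prod>k<q. fact k) * (\<Prod>k\<in>{q..<2 * q}. fact k :: real)"
    using prod.atLeastLessThan_concat[of 0 q "2 * q" "fact :: nat \<Rightarrow> real"] by (simp add: atLeast0LessThan)
  have pos: "(\<Prod>k<q. fact k :: real) > 0" "(\<Prod>k\<in>{q..<2 * q}. fact k :: real) > 0" "(\<Prod>i=1..q. fact (2 * i) :: real) > 0"
    "(\<Prod>i=1..q. fact i :: real) > 0"
    by (auto intro!: prod_pos)
  define B where "B = (\<Prod>i=1..q. fact (2 * i) :: real)"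
  define C where "C = (\<Prod>k<q. central_ratio k)"
  define D where "D = (\<Prod>k<q. fact k :: real)"
  define E where "E = (\<Prod>k\<in>{q..<2 * q}. fact k :: real)"
  define G where "G = (\<Prod>i=1..q. fact i :: real)"
  have eqs: "B\<^sup>2 = fact (2 * q) * 2 ^ q * fact q * (D * E)" "C * 2 ^ q * (G * D) = B"
    using double_fact_products[of q] c s by (simp_all add: B_def C_def D_def E_def G_def)
  have pos': "B > 0" "D > 0" "E > 0" "G > 0" using pos by (auto simp: B_def D_def E_def G_def)
  have "fact (2 * q) * 2 ^ q * fact q * E * D = (2 ^ q * C * G * B) * D"
    using eqs by (simp add: power2_eq_square mult_ac)
  then have "fact (2 * q) * 2 ^ q * fact q * E = 2 ^ q * C * G * B" using pos' by simp
  then have "fact (2 * q) / (B / 2 ^ q) = 2 ^ q / fact q * G * C / E"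
    using pos' by (simp add: field_simps)
  moreover have "dim_ratio q 0 = 1" by (simp add: dim_ratio_def)
  ultimately show ?case
    by (simp add: vdm_squares_atMost B_def C_def E_def G_def atLeast0LessThan)
next
  case (Suc m)
  let ?n = "q + m"
  let ?R = "\<lambda>m. 2 ^ (m + q) * (\<Prod>j<m. real q + 2 + 2 * real j) / fact (q + m) * (\<Prod>i=1..q. fact i) *
      (\<Prod>k\<in>{m..<m + q}. central_ratio k) / (\<Prod>k\<in>{q + 2 * m..<2 * q + 2 * m}. fact k)"
  define z where "z = (real q + 2 + 2 * real m) / (2 * real m + 1) * (fact m)\<^sup>2 * fact (q + 2 * m + 1) * fact (q + 2 * m) /
       (fact (q + m + 1) * fact (q + m) * fact (2 * m))"
  have Vpos: "vdm squares {..?n} > 0" by (rule vdm_squares_pos)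
  have left: "fact (2 * (q + Suc m)) * dim_ratio q (Suc m) / vdm squares {..q + Suc m} =
     fact (2 * ?n) * dim_ratio q m / vdm squares {..?n} * (2 * z / fact (2 * ?n))"
    unfolding dim_ratio_Suc add_Suc_right vdm_squares_atMost_Suc z_def[symmetric] using Vpos
    by (simp del: fact_Suc mult_Suc_right)
  have c_pos: "central_ratio k > 0" for k by (simp add: central_ratio_def)
  have cen: "(\<Prod>k\<in>{Suc m..<Suc m + q}. central_ratio k) = (\<Prod>k\<in>{m..<m + q}. central_ratio k) * (central_ratio ?n / central_ratio m)"
    using prod_interval_shift[of central_ratio m q] c_pos[of m] by (simp add: field_simps)
  have den: "(\<Prod>k\<in>{q + 2 * Suc m..<2 * q + 2 * Suc m}. fact k) * (fact (q + 2 * m) * fact (q + 2 * m + 1)) =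
     (\<Prod>k\<in>{q + 2 * m..<2 * q + 2 * m}. fact k) * (fact (2 * ?n) * (fact (2 * ?n + 1) :: real))"
    using prod_interval_shift[of "fact :: nat \<Rightarrow> real" "q + 2 * m" q]
      prod_interval_shift[of "fact :: nat \<Rightarrow> real" "Suc (q + 2 * m)" q]
    by (simp add: mult_2 add_ac mult_ac del: fact_Suc)
  have den': "X / (\<Prod>k\<in>{q + 2 * Suc m..<2 * q + 2 * Suc m}. fact k) =
    X / (\<Prod>k\<in>{q + 2 * m..<2 * q + 2 * m}. fact k) * (fact (q + 2 * m) * fact (q + 2 * m + 1) / (fact (2 * ?n) * fact (2 * ?n + 1)))" for X :: real
  proof -
    have d: "D1 = D0 * c / b" if "D1 * b = D0 * c" "b > 0" for D1 D0 b c :: real using that by (simp add: field_simps)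
    show ?thesis unfolding d[OF den mult_pos_pos[OF fact_gt_zero fact_gt_zero]] by (simp del: fact_Suc)
  qed
  have right: "?R (Suc m) = ?R m * (2 * (real q + 2 + 2 * real m) / (real ?n + 1) * (central_ratio ?n / central_ratio m) *
      (fact (q + 2 * m) * fact (q + 2 * m + 1) / (fact (2 * ?n) * fact (2 * ?n + 1))))"
  proof -
    have f: "fact (q + Suc m) = (real ?n + 1) * fact ?n" by simp
    have p: "(2::real) ^ (Suc m + q) = 2 * 2 ^ (m + q)" by simp
    show ?thesis unfolding den' cen f p prod.lessThan_Suc
      by (simp only: times_divide_eq_left times_divide_eq_right divide_divide_eq_left mult_ac)
  qed
  have "2 * z / fact (2 * ?n) = 2 * (real q + 2 + 2 * real m) / (real ?n + 1) * (central_ratio ?n / central_ratio m) *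
      (fact (q + 2 * m) * fact (q + 2 * m + 1) / (fact (2 * ?n) * fact (2 * ?n + 1)))"
  proof -
    have f1: "fact (q + m + 1) = (real ?n + 1) * (fact ?n :: real)" by simp
    have f2: "fact (2 * m + 1) = (2 * real m + 1) * (fact (2 * m) :: real)" by simp
    have alg: "2 * (x / o1 * F\<^sup>2 * A * B / (o2 * N * N * M)) / T = 2 * x / o2 * ((U / N\<^sup>2) / (o1 * M / F\<^sup>2)) * (B * A / (T * U))"
      if "F > 0" "N > 0" "M > 0" "T > 0" "U > 0" "o1 > 0" "o2 > 0" for x o1 o2 F A B N M T U :: real
    proof -
      have "X / (Y / Z) = X * Z / Y" for X Y Z :: real by simp
      then have "2 * x / o2 * ((U / N\<^sup>2) / (o1 * M / F\<^sup>2)) * (B * A / (T * U)) = (2 * x * F\<^sup>2 * A * B / (o1 * o2 * N\<^sup>2 * M * T)) * (U / U)"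
        by (simp only: times_divide_eq_left times_divide_eq_right divide_divide_eq_left power2_eq_square mult_ac)
      also have "U / U = 1" using that by simp
      finally show ?thesis
        by (simp only: times_divide_eq_left times_divide_eq_right divide_divide_eq_left power2_eq_square mult_ac mult_1_right)
    qed
    show ?thesis unfolding z_def central_ratio_def f1 f2 by (rule alg) (auto simp del: fact_Suc)
  qed
  then show ?case unfolding left right Suc.IH by simp
qed

lemma pos_notin_nonpos_Ints: "(x::real) > 0 \<Longrightarrow> x \<notin> \<int>\<^sub>\<le>\<^sub>0"
  by (auto simp: nonpos_Ints_def)

lemma Gamma_three_halves_pos: "Gamma (3 / 2 :: real) > 0"
  by (rule Gamma_real_pos) simp

lemma Gamma_nat_plus_three_halves:
  "Gamma (real k + 3 / 2) = Gamma (3 / 2) * (1 / 4) ^ k * fact (2 * k + 1) / fact k"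
proof (induction k)
  case (Suc k)
  have "Gamma (real (Suc k) + 3 / 2) = (real k + 3 / 2) * Gamma (real k + 3 / 2)"
    using Gamma_plus1[of "real k + 3 / 2"] by (simp add: add_ac plus_one_in_nonpos_Ints_imp nonpos_Ints_def) 
  also have "\<dots> = Gamma (3 / 2) * (1 / 4) ^ Suc k * ((2 * real k + 3) * (2 * real k + 2) * fact (2 * k + 1)) / ((real k + 1) * fact k)"
  proof -
    have alg: "w / 2 * (G * p * F / K) = G * (1 / 4 * p) * (w * (2 * y) * F) / (y * K)" if "y > 0" for w y G p F K :: real
      using that by simp
    have e: "real k + 3 / 2 = (2 * real k + 3) / 2" "2 * real k + 2 = 2 * (real k + 1)" by simp_all
    show ?thesis unfolding Suc.IH unfolding e power_Suc by (rule alg) simp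
  qed
  also have "(2 * real k + 3) * (2 * real k + 2) * fact (2 * k + 1) = fact (2 * Suc k + 1)" by (simp add: add_ac)
  also have "(real k + 1) * fact k = fact (Suc k)" by simp
  finally show ?case .
qed simp

text \<open>
  The duplication formula at half-integers, with sqrt \<pi> written as 2 \<Gamma> (3/2).
\<close>
lemma Gamma_half_duplication:
  "Gamma (1 + real r / 2) * Gamma ((real r + 1) / 2) = Gamma (3 / 2) * 2 * fact r / 2 ^ r"
proof (induction r)
  case 0
  have "Gamma (3 / 2 :: real) = 1 / 2 * Gamma (1 / 2)"
    using Gamma_plus1[of "1 / 2 :: real"] pos_notin_nonpos_Ints[of "1 / 2"] by simp
  then show ?case by simp
next
  case (Suc r)
  have "Gamma (1 + real (Suc r) / 2) = (real r + 1) / 2 * Gamma ((real r + 1) / 2)"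
    using Gamma_plus1[of "(real r + 1) / 2"] pos_notin_nonpos_Ints[of "(real r + 1) / 2"] by (simp add: add_ac)
  moreover have "(real (Suc r) + 1) / 2 = 1 + real r / 2" by (simp add: field_simps)
  ultimately have "Gamma (1 + real (Suc r) / 2) * Gamma ((real (Suc r) + 1) / 2) =
     (real r + 1) / 2 * (Gamma (1 + real r / 2) * Gamma ((real r + 1) / 2))"
    by (simp only: mult_ac)
  also have "\<dots> = Gamma (3 / 2) * 2 * fact (Suc r) / 2 ^ Suc r"
    unfolding Suc.IH by (simp add: field_simps)
  finally show ?case .
qed

lemma Gamma_add_nat:
  assumes "c > (0::real)"
  shows "Gamma (c + real m) = Gamma c * (\<Prod>j<m. c + real j)"
proof (induction m)
  case (Suc m)
  have "c + real m \<noteq> 0" using assms by linarith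
  have "Gamma (c + real (Suc m)) = (c + real m) * Gamma (c + real m)"
    using Gamma_plus1[of "c + real m"] assms by (simp add: add_ac nonpos_Ints_def)
  then show ?case using Suc by simp
qed simp

text \<open>
  The powers of two from the Gamma functions at half-integers almost cancel the power of two in
  \<open>gamma_product\<close>.
\<close>
lemma powr_quarter_product:
  assumes "q \<le> n"
  shows "2 powr (2 * real (Suc q) * real n - real (Suc q) * (real (Suc q) - 1)) * (\<Prod>i=1..q. (1 / 4) ^ (n - i)) = 4 ^ n"
  using assms
proof (induction q)
  case 0
  have "4 ^ n = (2::real) ^ (2 * n)" by (simp add: power_mult)
  then show ?case by (simp add: powr_realpow[symmetric])
next
  case (Suc q)
  let ?e = "2 * real (Suc q) * real n - real (Suc q) * (real (Suc q) - 1)"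
  have "2 * real (Suc (Suc q)) * real n - real (Suc (Suc q)) * (real (Suc (Suc q)) - 1) = ?e + real (2 * (n - Suc q))"
    using Suc.prems by (simp add: of_nat_diff algebra_simps)
  then have "2 powr (2 * real (Suc (Suc q)) * real n - real (Suc (Suc q)) * (real (Suc (Suc q)) - 1)) = 2 powr ?e * 4 ^ (n - Suc q)"
    by (simp only: powr_add powr_realpow) (simp add: power_mult)
  then have "2 powr (2 * real (Suc (Suc q)) * real n - real (Suc (Suc q)) * (real (Suc (Suc q)) - 1)) * (\<Prod>i=1..Suc q. (1 / 4) ^ (n - i))
    = (2 powr ?e * (\<Prod>i=1..q. (1 / 4) ^ (n - i))) * (4 ^ (n - Suc q) * (1 / 4) ^ (n - Suc q))"
    by simp
  also have "(4::real) ^ (n - Suc q) * (1 / 4) ^ (n - Suc q) = 1" by (simp flip: power_mult_distrib)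
  finally show ?case using Suc.IH[OF Suc_leD[OF Suc.prems]] by (simp only: mult_1_right)
qed

lemma rGamma_nat_plus1: "rGamma (real k + 1) = 1 / fact k"
  using Gamma_fact[of k, where 'a = real] by (simp add: rGamma_inverse_Gamma add.commute inverse_eq_divide)

text \<open>
  The two Gamma functions that involve r / 2 are evaluated together: the functional equation moves them
  to arguments that differ by 1/2, where the duplication formula applies whatever the parity of r.
  All other arguments are positive integers or half-integers and are treated one by one.
\<close>
lemma gamma_product_closed_form:
  assumes n: "n = q + m"
  shows "gamma_product (Suc q) (real n) =
    2 ^ (2 * m + q) * fact (Suc q) * (\<Prod>j<m. (real q + 2) / 2 + real j) / fact n * fact (2 * n) ^ q *
     (\<Prod>i=1..q. fact i * central_ratio (n - i) / fact (2 * n - i))"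
proof -
  let ?G = "Gamma (3 / 2 :: real)"
  let ?r = "real (Suc q)"
  have G0: "?G \<noteq> 0" using Gamma_three_halves_pos by (rule less_imp_neq[symmetric])
  have "(\<Prod>i = 1..Suc q - 1. (Gamma (real i + 1) / ?G) *
        (Gamma (2 * real n + 1) * Gamma (real n - real i + 3 / 2) * rGamma (2 * real n - real i + 1) * rGamma (real n - real i + 1)))
    = (\<Prod>i = 1..q. fact (2 * n) * ((1 / 4) ^ (n - i) * (fact i * central_ratio (n - i) / fact (2 * n - i))))"
  proof (rule prod.cong)
    fix i assume "i \<in> {1..q}"
    then have i: "i \<le> n" using n by auto
    have e: "real n - real i = real (n - i)" "2 * real n - real i = real (2 * n - i)" "2 * real n = real (2 * n)"
      using i by (auto simp: of_nat_diff)
    have gf: "Gamma (real k + 1) = fact k" for k using Gamma_fact[of k, where 'a = real] by (simp add: add.commute)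
    from G0 show "(Gamma (real i + 1) / ?G) *
        (Gamma (2 * real n + 1) * Gamma (real n - real i + 3 / 2) * rGamma (2 * real n - real i + 1) * rGamma (real n - real i + 1))
       = fact (2 * n) * ((1 / 4) ^ (n - i) * (fact i * central_ratio (n - i) / fact (2 * n - i)))"
      unfolding e(1,2) unfolding e(3) Gamma_nat_plus_three_halves rGamma_nat_plus1 gf
      by (simp add: central_ratio_def power2_eq_square mult_ac del: fact_Suc)
  qed simp
  also have "\<dots> = fact (2 * n) ^ q * ((\<Prod>i=1..q. (1 / 4) ^ (n - i)) * (\<Prod>i=1..q. fact i * central_ratio (n - i) / fact (2 * n - i)))"
    unfolding prod.distrib by simp
  finally have P: "(\<Prod>i = 1..Suc q - 1. (Gamma (real i + 1) / ?G) *
        (Gamma (2 * real n + 1) * Gamma (real n - real i + 3 / 2) * rGamma (2 * real n - real i + 1) * rGamma (real n - real i + 1))) = \<dots>" .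
  have arg: "real n - ?r / 2 + 3 / 2 = (?r + 1) / 2 + real m" using n by (simp add: field_simps)
  have c: "(?r + 1) / 2 = (real q + 2) / 2" by simp
  have "Gamma (1 + ?r / 2) / ?G * (Gamma (real n - ?r / 2 + 3 / 2) * rGamma (real n + 1)) =
     (Gamma (1 + ?r / 2) * Gamma ((?r + 1) / 2)) / ?G * (\<Prod>j<m. (?r + 1) / 2 + real j) / fact n"
    unfolding arg rGamma_nat_plus1 by (subst Gamma_add_nat) auto
  also have "\<dots> = 2 * fact (Suc q) / 2 ^ Suc q * (\<Prod>j<m. (?r + 1) / 2 + real j) / fact n"
    unfolding Gamma_half_duplication using G0 by (simp del: fact_Suc)
  finally have F: "Gamma (1 + ?r / 2) / ?G * (Gamma (real n - ?r / 2 + 3 / 2) * rGamma (real n + 1)) =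
     2 * fact (Suc q) / 2 ^ Suc q * (\<Prod>j<m. (real q + 2) / 2 + real j) / fact n" unfolding c .
  have two: "(4::real) ^ n * (2 / 2 ^ Suc q) = 2 ^ (2 * m + q)"
  proof -
    have "(4::real) ^ n = 2 ^ (2 * n)" by (simp add: power_mult)
    also have "2 * n = q + (2 * m + q)" using n by simp
    finally have "(4::real) ^ n = 2 ^ q * 2 ^ (2 * m + q)" by (simp only: power_add)
    then show ?thesis by (simp del: power_add)
  qed
  have "gamma_product (Suc q) (real n) = 2 powr (2 * ?r * real n - ?r * (?r - 1)) *
     (Gamma (1 + ?r / 2) / ?G * (Gamma (real n - ?r / 2 + 3 / 2) * rGamma (real n + 1))) *
     (fact (2 * n) ^ q * ((\<Prod>i=1..q. (1 / 4) ^ (n - i)) * (\<Prod>i=1..q. fact i * central_ratio (n - i) / fact (2 * n - i))))"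
    unfolding gamma_product_def P by (simp only: mult.assoc)
  also have "\<dots> = (2 powr (2 * ?r * real n - ?r * (?r - 1)) * (\<Prod>i=1..q. (1 / 4) ^ (n - i))) * (2 / 2 ^ Suc q) *
      fact (Suc q) * (\<Prod>j<m. (real q + 2) / 2 + real j) / fact n * fact (2 * n) ^ q * (\<Prod>i=1..q. fact i * central_ratio (n - i) / fact (2 * n - i))"
    unfolding F by (simp del: fact_Suc)
  also have "2 powr (2 * ?r * real n - ?r * (?r - 1)) * (\<Prod>i=1..q. (1 / 4) ^ (n - i)) = 4 ^ n"
    using n by (intro powr_quarter_product) simp
  finally show ?thesis unfolding two .
qed

lemma binomial_sum_eq_gamma_product:
  assumes n: "n = q + m"
  shows "real_of_int (binomial_sum (Suc q) n) = gamma_product (Suc q) (real n)"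
proof -
  have two: "2 ^ (2 * m + q) * (\<Prod>j<m. (real q + 2) / 2 + real j) = 2 ^ (m + q) * (\<Prod>j<m. real q + 2 + 2 * real j)"
  proof -
    have "(\<Prod>j<m. real q + 2 + 2 * real j) = (\<Prod>j<m. 2 * ((real q + 2) / 2 + real j))"
      by (intro prod.cong refl) (simp add: field_simps)
    also have "\<dots> = 2 ^ m * (\<Prod>j<m. (real q + 2) / 2 + real j)"
      by (simp only: prod.distrib prod_constant card_lessThan)
    finally have e: "(\<Prod>j<m. real q + 2 + 2 * real j) = 2 ^ m * (\<Prod>j<m. (real q + 2) / 2 + real j)" .
    have "2 * m + q = (m + q) + m" by simp
    then have "(2::real) ^ (2 * m + q) = 2 ^ (m + q) * 2 ^ m" by (simp only: power_add)
    then show ?thesis unfolding e by (simp only: mult.assoc)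
  qed
  have cen: "(\<Prod>i=1..q. central_ratio (n - i)) = (\<Prod>k\<in>{m..<m + q}. central_ratio k)"
    by (rule prod.reindex_bij_witness[of _ "\<lambda>k. n - k" "\<lambda>i. n - i"]) (use n in auto)
  have den: "(\<Prod>i=1..q. fact (2 * n - i) :: real) = (\<Prod>k\<in>{q + 2 * m..<2 * q + 2 * m}. fact k)"
    by (rule prod.reindex_bij_witness[of _ "\<lambda>k. 2 * n - k" "\<lambda>i. 2 * n - i"]) (use n in auto)
  have "real_of_int (binomial_sum (Suc q) n) = fact (Suc q) * fact (2 * n) ^ q * (fact (2 * (q + m)) * dim_ratio q m / vdm squares {..q + m})"
    using binomial_sum_eq_sum_subsets[of "Suc q" m n] n by (simp add: sum_vdm_eq_dim_ratio del: fact_Suc)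
  also have "\<dots> = fact (Suc q) * fact (2 * n) ^ q *
     ((2 ^ (2 * m + q) * (\<Prod>j<m. (real q + 2) / 2 + real j)) / fact n * (\<Prod>i=1..q. fact i) *
      (\<Prod>i=1..q. central_ratio (n - i)) / (\<Prod>i=1..q. fact (2 * n - i)))"
    unfolding dim_ratio_closed_form two cen den unfolding n ..
  also have "\<dots> = gamma_product (Suc q) (real n)"
    unfolding gamma_product_closed_form[OF n] prod.distrib prod_dividef by (simp del: fact_Suc)
  finally show ?thesis .
qed

text \<open>
  The factor i = n + 1 of the product contains 1 / \<Gamma> (0).
\<close>
lemma gamma_product_zero:
  assumes "n + 2 \<le> r"
  shows "gamma_product r (real n) = 0"
proof -
  have "Suc n \<in> {1..r - 1}" using assms by auto
  then have "(\<Prod>i = 1..r - 1. (Gamma (real i + 1) / Gamma (3 / 2)) *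
        (Gamma (2 * real n + 1) * Gamma (real n - real i + 3 / 2) *
         rGamma (2 * real n - real i + 1) * rGamma (real n - real i + 1))) = 0"
    by (intro prod_zero bexI[of _ "Suc n"]) auto
  then show ?thesis unfolding gamma_product_def by simp
qed

lemma tendsto_rGamma_real:
  fixes f :: "'a \<Rightarrow> real"
  assumes "(f \<longlongrightarrow> c) F"
  shows "((\<lambda>z. rGamma (f z)) \<longlongrightarrow> rGamma c) F"
  by (rule isCont_tendsto_compose[OF _ assms]) (intro continuous_intros)

text \<open>
  A pole of the numerator forces r \<ge> 2 n + 3, so the factors with i = n + 1 and i = n + 2 are both
  present. The zero of the former cancels the simple pole, and the zero of the latter remains.
\<close>
lemma gamma_product_pole_tendsto:
  assumes pole: "real n - real r / 2 + 3 / 2 \<in> \<int>\<^sub>\<le>\<^sub>0"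
  shows "((\<lambda>\<epsilon>. gamma_product r (real n + \<epsilon>)) \<longlongrightarrow> 0) (at 0)"
proof -
  obtain k where k: "real n - real r / 2 + 3 / 2 = - real k"
    using pole by (auto elim!: nonpos_Ints_cases')
  then have "real r = real (2 * n + 2 * k + 3)" by simp
  then have r: "r = 2 * n + 2 * k + 3" by (simp only: of_nat_eq_iff)
  let ?T = "\<lambda>i \<epsilon>. (Gamma (real i + 1) / Gamma (3 / 2)) *
     (Gamma (2 * (real n + \<epsilon>) + 1) * Gamma (real n + \<epsilon> - real i + 3 / 2) *
       rGamma (2 * (real n + \<epsilon>) - real i + 1) * rGamma (real n + \<epsilon> - real i + 1))"
  let ?U = "\<lambda>\<epsilon>. (Gamma (real (Suc n) + 1) / Gamma (3 / 2)) *
     (Gamma (2 * (real n + \<epsilon>) + 1) * Gamma (real n + \<epsilon> - real (Suc n) + 3 / 2) *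
       rGamma (2 * (real n + \<epsilon>) - real (Suc n) + 1) * rGamma (\<epsilon> + 1))"
  let ?J = "{1..r - 1} - {Suc n}"
  have half: "real n - real i + 3 / 2 \<notin> \<int>\<^sub>\<le>\<^sub>0" for i
  proof
    assume "real n - real i + 3 / 2 \<in> \<int>\<^sub>\<le>\<^sub>0"
    then obtain l where "real n - real i + 3 / 2 = - real l" by (auto elim!: nonpos_Ints_cases')
    then have "real (2 * n + 2 * l + 3) = real (2 * i)" by simp
    then have "2 * n + 2 * l + 3 = 2 * i" by (simp only: of_nat_eq_iff)
    then show False by presburger
  qed
  have pos: "2 * real n + 1 \<notin> \<int>\<^sub>\<le>\<^sub>0" by (auto simp: nonpos_Ints_def)
  have half': "real n + 0 - real i + 3 / 2 \<notin> \<int>\<^sub>\<le>\<^sub>0" and pos': "2 * (real n + 0) + 1 \<notin> \<int>\<^sub>\<le>\<^sub>0" for i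
    using half[of i] pos by simp_all
  have T: "(?T i \<longlongrightarrow> ?T i 0) (at 0)" for i
    by (intro tendsto_intros tendsto_rGamma_real half' pos')
  have U: "(?U \<longlongrightarrow> ?U 0) (at 0)"
    by (intro tendsto_intros tendsto_rGamma_real half' pos')
  have G: "((\<lambda>\<epsilon>. Gamma (real n + \<epsilon> - real r / 2 + 3 / 2) * \<epsilon>) \<longlongrightarrow> (-1) ^ k / fact k) (at 0)"
  proof -
    have "((\<lambda>z. Gamma z * (z + real k)) \<longlongrightarrow> (-1) ^ k / fact k) (at (- real k))"
      by (rule Gamma_residues)
    then have "((\<lambda>\<epsilon>. Gamma (\<epsilon> + - real k) * (\<epsilon> + - real k + real k)) \<longlongrightarrow> (-1) ^ k / fact k) (at 0)"
      using LIM_offset_zero[of "\<lambda>z. Gamma z * (z + real k)" _ "- real k"] by (simp add: add.commute)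
    moreover have e: "real n + \<epsilon> - real r / 2 + 3 / 2 = \<epsilon> + - real k" for \<epsilon> using k by simp
    ultimately show ?thesis unfolding e by simp
  qed
  have Z: "(\<Prod>i\<in>?J. ?T i 0) = 0"
  proof (intro prod_zero bexI[of _ "n + 2"])
    have "rGamma (real n + 0 - real (n + 2) + 1) = (0 :: real)"
      by (simp add: rGamma_eq_zero_iff)
    then show "?T (n + 2) 0 = 0" by simp
  qed (use r in auto)
  \<comment> \<open>The zero of 1 / \<Gamma> at 0 is split off as a factor \<epsilon> and attached to the pole.\<close>
  have eq: "gamma_product r (real n + \<epsilon>) =
     2 powr (2 * real r * (real n + \<epsilon>) - real r * (real r - 1)) * (Gamma (1 + real r / 2) / Gamma (3 / 2)) *
      ((Gamma (real n + \<epsilon> - real r / 2 + 3 / 2) * \<epsilon>) * rGamma (real n + \<epsilon> + 1)) * (?U \<epsilon> * (\<Prod>i\<in>?J. ?T i \<epsilon>))" for \<epsilon>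
  proof -
    have "Suc n \<in> {1..r - 1}" using r by auto
    then have "(\<Prod>i = 1..r - 1. ?T i \<epsilon>) = ?T (Suc n) \<epsilon> * (\<Prod>i\<in>?J. ?T i \<epsilon>)"
      by (intro prod.remove) auto
    also have "?T (Suc n) \<epsilon> = \<epsilon> * ?U \<epsilon>"
    proof -
      have "rGamma (real n + \<epsilon> - real (Suc n) + 1) = \<epsilon> * rGamma (\<epsilon> + 1)"
        using rGamma_plus1[of \<epsilon>] by simp
      then show ?thesis by (simp only: mult_ac)
    qed
    finally show ?thesis unfolding gamma_product_def by (simp only: mult_ac)
  qed
  have "((\<lambda>\<epsilon>. 2 powr (2 * real r * (real n + \<epsilon>) - real r * (real r - 1)) * (Gamma (1 + real r / 2) / Gamma (3 / 2)) *
      ((Gamma (real n + \<epsilon> - real r / 2 + 3 / 2) * \<epsilon>) * rGamma (real n + \<epsilon> + 1)) * (?U \<epsilon> * (\<Prod>i\<in>?J. ?T i \<epsilon>))) \<longlongrightarrow>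
     2 powr (2 * real r * (real n + 0) - real r * (real r - 1)) * (Gamma (1 + real r / 2) / Gamma (3 / 2)) *
      (((-1) ^ k / fact k) * rGamma (real n + 0 + 1)) * (?U 0 * (\<Prod>i\<in>?J. ?T i 0))) (at 0)"
    by (intro tendsto_mult tendsto_prod T U G tendsto_powr tendsto_rGamma_real tendsto_add tendsto_diff tendsto_const tendsto_ident_at) auto
  then show ?thesis unfolding eq Z by simp
qed

theorem proposition1p1:
  fixes r n :: nat
  assumes "r \<ge> 1"
  shows "if real n - real r / 2 + 3 / 2 \<in> \<int>\<^sub>\<le>\<^sub>0
         then ((\<lambda>\<epsilon>. gamma_product r (real n + \<epsilon>)) \<longlongrightarrow> real_of_int (binomial_sum r n)) (at 0)
         else real_of_int (binomial_sum r n) = gamma_product r (real n)"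
proof (cases "r \<le> n + 1")
  case True
  then have "real n - real r / 2 + 3 / 2 > 0" by linarith
  then have "real n - real r / 2 + 3 / 2 \<notin> \<int>\<^sub>\<le>\<^sub>0" by (auto simp: nonpos_Ints_def)
  moreover obtain q where q: "r = Suc q" using assms by (cases r) auto
  then obtain m where "n = q + m" using True le_Suc_ex by auto
  ultimately show ?thesis using binomial_sum_eq_gamma_product[of n q m] q by simp
next
  case False
  then have "binomial_sum r n = 0" "n + 2 \<le> r" using binomial_sum_eq_0[of n r] by auto
  then show ?thesis using gamma_product_pole_tendsto[of n r] gamma_product_zero[of n r] by simp
qed

end
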